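(* Let $S_{\boldsymbol\lambda}$ be a weighted shift on a directed tree $\mathscr T=(V,E)$ with weights $\boldsymbol\lambda=\{\lambda_v\}_{v\in V^\circ}\subseteq\mathbb C$ such that $\mathscr E_V\subseteq \mathcal D^\infty(S_{\boldsymbol\lambda})$. Suppose that there exist a system $\{\mu_v\}_{v\in V}$ of Borel probability measures on $\mathbb R_+$ and a system $\{\varepsilon_v\}_{v\in V}$ of nonnegative real numbers such that for every $u\in V$, $$\mu_u(\sigma)=\sum_{v\in \mathrm{Chi}(u)}|\lambda_v|^2\int_\sigma \frac1s\,d\mu_v(s)+\varepsilon_u\,\delta_0(\sigma)\quad\text{for every Borel set }\sigma\subseteq\mathbb R_+ .$$ Then $S_{\boldsymbol\lambda}$ is subnormal.
   Context: A directed graph is a pair $\mathscr T=(V,E)$, where $V$ is a nonempty set (vertices) and $E\subseteq\{(u,v)\in V\times V: u\neq v\}$ (edges). A vertex $v$ is a root if there is no $u\in V$ with $(u,v)\in E$; $V^\circ$ is the set of non-root vertices. $\mathscr T$ is a directed tree if it is connected (as an undirected graph), has no circuits (no distinct $u_1,\dots,u_n$, $n\ge2$, with $(u_j,u_{j+1})\in E$ for $1\le j<n$ and $(u_n,u_1)\in E$), and each $v\in V^\circ$ has a parent, i.e. a unique vertex $\mathrm{par}(v)$ with $(\mathrm{par}(v),v)\in E$. A directed tree has at most one root, denoted $\mathrm{root}$. $\mathrm{Chi}(u)=\{v\in V:(u,v)\in E\}$. $\ell^2(V)$ is the Hilbert space of square summable complex functions on $V$, $e_u$ is the characteristic function of $\{u\}$,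 and $\mathscr E_V$ is the linear span of $\{e_u:u\in V\}$. The weighted shift $S_{\boldsymbol\lambda}$ on $\mathscr T$ with weights $\{\lambda_v\}_{v\in V^\circ}$ is the operator in $\ell^2(V)$ with domain $\{f\in\ell^2(V):\Lambda f\in\ell^2(V)\}$ and $S_{\boldsymbol\lambda}f=\Lambda f$, where $(\Lambda f)(v)=\lambda_v f(\mathrm{par}(v))$ for $v\in V^\circ$ and $(\Lambda f)(\mathrm{root})=0$. For an operator $A$, $\mathcal D^\infty(A)=\bigcap_{n\ge0}\mathcal D(A^n)$. A densely defined operator $S$ in a complex Hilbert space $\mathcal H$ is subnormal if there are a complex Hilbert space $\mathcal K\supseteq\mathcal H$ (isometric embedding) and a normal (possibly unbounded) operator $N$ in $\mathcal K$ such that $Sh=Nh$ for all $h\in\mathcal D(S)$. Conventions: $\mathbb R_+=[0,\infty)$; $\delta_0$ is the Borel probability measure on $\mathbb R_+$ concentrated at $0$; $\frac10=\infty$, $0\cdot\infty=0$; empty sums are $0$. *)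

theory Defs
  imports "HOL-Probability.Probability" "HOL-Algebra.Module"
begin

section \<open>Complex Hilbert spaces with an explicit carrier\<close>

definition complex_ring :: "complex ring" where
  "complex_ring = \<lparr>carrier = UNIV, monoid.mult = (*), one = 1, ring.zero = 0, add = (+)\<rparr>"

text \<open>As everywhere for the library's modules, the fields \<open>mult\<close> and \<open>one\<close> inherited from
  \<^type>\<open>ring\<close> play no role. The inner product is linear in its first argument.\<close>

record 'a inner_space = "(complex, 'a) module" +
  ip :: "'a \<Rightarrow> 'a \<Rightarrow> complex"

locale complex_inner_product_space = Module.module complex_ring H
  for H :: "'a inner_space" (structure) +
  assumes ip_add: "\<lbrakk>x \<in> carrier H; y \<in> carrier H; z \<in> carrier H\<rbrakk>
      \<Longrightarrow> ip H (x \<oplus> y) z = ip H x z + ip H y z"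
    and ip_smult: "\<lbrakk>x \<in> carrier H; y \<in> carrier H\<rbrakk> \<Longrightarrow> ip H (c \<odot> x) y = c * ip H x y"
    and ip_cnj: "\<lbrakk>x \<in> carrier H; y \<in> carrier H\<rbrakk> \<Longrightarrow> ip H y x = cnj (ip H x y)"
    and ip_nonneg: "x \<in> carrier H \<Longrightarrow> Re (ip H x x) \<ge> 0"
    and ip_definite: "\<lbrakk>x \<in> carrier H; ip H x x = 0\<rbrakk> \<Longrightarrow> x = \<zero>"

definition hnorm :: "'a inner_space \<Rightarrow> 'a \<Rightarrow> real" where
  "hnorm H x = sqrt (Re (ip H x x))"

text \<open>The value outside the carrier is fixed because \<^locale>\<open>Metric_space\<close> demands
  nonnegativity and symmetry on the whole type.\<close>

definition hdist :: "'a inner_space \<Rightarrow> 'a \<Rightarrow> 'a \<Rightarrow> real" where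
  "hdist H x y = (if x \<in> carrier H \<and> y \<in> carrier H then hnorm H (x \<ominus>\<^bsub>H\<^esub> y) else 0)"

abbreviation htopology :: "'a inner_space \<Rightarrow> 'a topology" where
  "htopology H \<equiv> Metric_space.mtopology (carrier H) (hdist H)"

locale complex_hilbert_space = complex_inner_product_space +
  assumes complete: "Metric_space.mcomplete (carrier H) (hdist H)"


section \<open>Unbounded operators\<close>

text \<open>An operator is identified with its graph, a subset of \<open>carrier H \<times> carrier H\<close>, so that
  \<^const>\<open>Domain\<close> is its domain, \<open>A O B\<close> is the product \<open>B A\<close> (first \<open>A\<close>, then \<open>B\<close>) on its
  maximal domain, and equality of operators includes equality of domains.\<close>

definition linear_operator :: "'a inner_space \<Rightarrow> 'a rel \<Rightarrow> bool" where
  "linear_operator H A \<longleftrightarrow>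
     A \<subseteq> carrier H \<times> carrier H \<and> single_valued A \<and> (\<zero>\<^bsub>H\<^esub>, \<zero>\<^bsub>H\<^esub>) \<in> A \<and>
     (\<forall>f f' g g'. (f, f') \<in> A \<longrightarrow> (g, g') \<in> A \<longrightarrow> (f \<oplus>\<^bsub>H\<^esub> g, f' \<oplus>\<^bsub>H\<^esub> g') \<in> A) \<and>
     (\<forall>c f f'. (f, f') \<in> A \<longrightarrow> (c \<odot>\<^bsub>H\<^esub> f, c \<odot>\<^bsub>H\<^esub> f') \<in> A)"

definition densely_defined :: "'a inner_space \<Rightarrow> 'a rel \<Rightarrow> bool" where
  "densely_defined H A \<longleftrightarrow> htopology H closure_of Domain A = carrier H"

definition closed_operator :: "'a inner_space \<Rightarrow> 'a rel \<Rightarrow> bool" where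
  "closed_operator H A \<longleftrightarrow> closedin (prod_topology (htopology H) (htopology H)) A"

text \<open>Single-valued precisely when \<open>A\<close> is densely defined.\<close>

definition adjoint_operator :: "'a inner_space \<Rightarrow> 'a rel \<Rightarrow> 'a rel" where
  "adjoint_operator H A =
     {(g, h). g \<in> carrier H \<and> h \<in> carrier H \<and> (\<forall>(f, f') \<in> A. ip H f' g = ip H f h)}"

definition normal_operator :: "'a inner_space \<Rightarrow> 'a rel \<Rightarrow> bool" where
  "normal_operator H N \<longleftrightarrow>
     linear_operator H N \<and> densely_defined H N \<and> closed_operator H N \<and>
     N O adjoint_operator H N = adjoint_operator H N O N"

definition D_infinity :: "'a inner_space \<Rightarrow> 'a rel \<Rightarrow> 'a set" where
  "D_infinity H A = carrier H \<inter> (\<Inter>n. Domain (A ^^ n))"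

definition isometric_embedding :: "'a inner_space \<Rightarrow> 'b inner_space \<Rightarrow> ('a \<Rightarrow> 'b) \<Rightarrow> bool" where
  "isometric_embedding H K J \<longleftrightarrow>
     J \<in> carrier H \<rightarrow> carrier K \<and>
     (\<forall>x \<in> carrier H. \<forall>y \<in> carrier H. J (x \<oplus>\<^bsub>H\<^esub> y) = J x \<oplus>\<^bsub>K\<^esub> J y) \<and>
     (\<forall>c. \<forall>x \<in> carrier H. J (c \<odot>\<^bsub>H\<^esub> x) = c \<odot>\<^bsub>K\<^esub> J x) \<and>
     (\<forall>x \<in> carrier H. \<forall>y \<in> carrier H. ip K (J x) (J y) = ip H x y)"

text \<open>HOL has no quantification over types, so the elements of the larger space \<open>K\<close> are coded
  in \<^typ>\<open>nat \<Rightarrow> 'a\<close>; the operations and the inner product of \<open>K\<close> remain arbitrary. This is no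
  restriction. Given any normal extension \<open>N\<close> with spectral measure \<open>P\<close>, the closed span of
  the vectors \<open>P \<sigma> (J h)\<close> with \<open>h \<in> carrier H\<close> reduces \<open>N\<close> to a normal extension. It has a dense
  subset of size at most \<open>max (\<aleph>\<^sub>0, |carrier H|)\<close> (the Borel sets \<open>\<sigma>\<close> may be taken from a
  countable generating algebra), hence its cardinality is at most that of
  \<open>nat \<Rightarrow> carrier H\<close>.\<close>

definition subnormal :: "'a inner_space \<Rightarrow> 'a rel \<Rightarrow> bool" where
  "subnormal H S \<longleftrightarrow>
     complex_hilbert_space H \<and> linear_operator H S \<and> densely_defined H S \<and>
     (\<exists>(K :: (nat \<Rightarrow> 'a) inner_space) J N.
        complex_hilbert_space K \<and> isometric_embedding H K J \<and> normal_operator K N \<and>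
        (\<forall>(h, h') \<in> S. (J h, J h') \<in> N))"


section \<open>Directed trees\<close>

definition nonroots :: "'v set \<Rightarrow> 'v rel \<Rightarrow> 'v set" where
  "nonroots V E = {v \<in> V. \<exists>u \<in> V. (u, v) \<in> E}"

locale directed_tree =
  fixes V :: "'v set" and E :: "'v rel"
  assumes nonempty: "V \<noteq> {}"
    and edges: "E \<subseteq> {(u, v). u \<in> V \<and> v \<in> V \<and> u \<noteq> v}"
    and connected: "\<And>u v. \<lbrakk>u \<in> V; v \<in> V\<rbrakk> \<Longrightarrow> (u, v) \<in> (E \<union> E\<inverse>)\<^sup>*"
    and no_circuit: "\<nexists>us. length us \<ge> 2 \<and> distinct us \<and>
        successively (\<lambda>u v. (u, v) \<in> E) us \<and> (last us, hd us) \<in> E"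
    and parent_unique: "\<And>v. v \<in> nonroots V E \<Longrightarrow> \<exists>!u. (u, v) \<in> E"

definition par :: "'v rel \<Rightarrow> 'v \<Rightarrow> 'v" where
  "par E v = (THE u. (u, v) \<in> E)"

definition Chi :: "'v rel \<Rightarrow> 'v \<Rightarrow> 'v set" where
  "Chi E u = {v. (u, v) \<in> E}"


section \<open>Weighted shifts\<close>

text \<open>Functions on \<open>V\<close> are represented by their extensions by zero to the whole type.\<close>

definition ell2 :: "'v set \<Rightarrow> ('v \<Rightarrow> complex) inner_space" where
  "ell2 V = \<lparr>carrier = {f. (\<forall>v. v \<notin> V \<longrightarrow> f v = 0) \<and> (\<lambda>v. (cmod (f v))\<^sup>2) summable_on V},
     monoid.mult = undefined, one = undefined,
     ring.zero = (\<lambda>v. 0), add = (\<lambda>f g v. f v + g v), smult = (\<lambda>c f v. c * f v),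
     ip = (\<lambda>f g. \<Sum>\<^sub>\<infinity>v\<in>V. f v * cnj (g v))\<rparr>"

definition basis_vec :: "'v \<Rightarrow> 'v \<Rightarrow> complex" where
  "basis_vec u = indicator {u}"

definition E_span :: "'v set \<Rightarrow> ('v \<Rightarrow> complex) set" where
  "E_span V = {f. \<exists>T c. finite T \<and> T \<subseteq> V \<and> f = (\<lambda>x. \<Sum>u\<in>T. c u * basis_vec u x)}"

definition shift_map ::
    "'v set \<Rightarrow> 'v rel \<Rightarrow> ('v \<Rightarrow> complex) \<Rightarrow> ('v \<Rightarrow> complex) \<Rightarrow> 'v \<Rightarrow> complex" where
  "shift_map V E lam f v = (if v \<in> nonroots V E then lam v * f (par E v) else 0)"

definition weighted_shift :: "'v set \<Rightarrow> 'v rel \<Rightarrow> ('v \<Rightarrow> complex) \<Rightarrow> ('v \<Rightarrow> complex) rel" where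
  "weighted_shift V E lam =
     {(f, shift_map V E lam f) | f.
        f \<in> carrier (ell2 V) \<and> shift_map V E lam f \<in> carrier (ell2 V)}"

abbreviation borel_Rplus :: "real measure" where
  "borel_Rplus \<equiv> restrict_space borel {0..}"

end

theory Submission
  imports Defs
begin

text \<open>Let \<open>\<H>\<close> be the direct sum of the spaces \<open>L\<^sup>2(\<mu>\<^sub>v)\<close>, seen as a space of functions of
  \<open>(v, s)\<close>. Because every \<open>\<mu>\<^sub>v\<close> is a probability measure, \<open>\<ell>\<^sup>2(V)\<close> embeds isometrically in it as
  the functions that do not depend on \<open>s\<close>, and the weighted shift is the restriction of the operator
  \<open>W\<close> that sends \<open>F\<close> to \<open>(v, s) \<mapsto> \<lambda>\<^sub>v F(par v, s)\<close>. The condition that relates \<open>\<mu>\<^sub>u\<close> to the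
  measures at the children of \<open>u\<close> says precisely that \<open>W = U M\<close>, where \<open>M\<close> is multiplication by the
  square root of \<open>s\<close> and \<open>U\<close>, which maps \<open>F\<close> to \<open>\<lambda>\<^sub>v s\<^sup>-\<^sup>1\<^sup>/\<^sup>2 F(par v, s)\<close>, preserves the norm of
  functions living on \<open>s > 0\<close> (lemma \<open>nn_integral_push\<close>). On \<open>s = 0\<close>, which \<open>M\<close> annihilates, let
  \<open>U\<close> be the identity. Then \<open>U\<close> is an isometry. It commutes with \<open>M\<close>, which acts in the other
  variable, so \<open>W\<close> is what is called a quasinormal operator.

  Such an operator has a normal extension (\<open>isometry_selfadjoint_normal_extension\<close>). The block
  matrix with rows \<open>(U, 1 - U U\<^sup>*)\<close> and \<open>(0, U\<^sup>*)\<close> is a unitary \<open>Q\<close> on two copies of \<open>\<H>\<close>, it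
  commutes with two copies of the self-adjoint operator \<open>M\<close>, and its product with these is
  normal (\<open>normal_operator_unitary_selfadjoint\<close>) and extends \<open>U M\<close>. That products of
  unbounded operators have the right domains causes no difficulty, because \<open>Q\<close> maps the domain
  of \<open>M \<oplus> M\<close> onto itself. The existence of \<open>U\<^sup>*\<close> and the density of domains both come
  from the projection theorem (\<open>projection\<close>).

  The larger space has to consist of functions from \<open>nat\<close> to functions on \<open>V\<close>. An element \<open>F\<close>
  of \<open>\<H>\<close> is therefore named by the integrals of \<open>F(v, \<cdot>)\<close> over the half lines with rational end
  points, which determine it almost everywhere, and pairs of names are interleaved.\<close>

section \<open>Elementary geometry of Hilbert spaces with a carrier\<close>

lemma complex_ring_simps [simp]:
  "carrier complex_ring = UNIV" "\<one>\<^bsub>complex_ring\<^esub> = 1" "\<zero>\<^bsub>complex_ring\<^esub> = 0"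
  "x \<otimes>\<^bsub>complex_ring\<^esub> y = x * y" "x \<oplus>\<^bsub>complex_ring\<^esub> y = x + y"
  by (simp_all add: complex_ring_def)

lemma cring_complex_ring: "cring complex_ring"
proof (rule cringI)
  show "abelian_group complex_ring"
    by (rule abelian_groupI) (auto simp: add.assoc add.commute intro: exI[of _ "- x" for x])
  show "comm_monoid complex_ring"
    by (rule comm_monoidI) (auto simp: mult.assoc mult.commute)
qed (simp add: distrib_right)

context complex_inner_product_space
begin

lemma smult_mem [simp, intro]: "x \<in> carrier H \<Longrightarrow> c \<odot> x \<in> carrier H"
  using smult_closed[of c x] by simp

lemma ip_minus:
  assumes "x \<in> carrier H" "y \<in> carrier H" "z \<in> carrier H"
  shows "ip H (x \<ominus> y) z = ip H x z - ip H y z"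
proof -
  have "(x \<ominus> y) \<oplus> y = x"
    using assms by (simp add: M.minus_eq M.a_assoc M.l_neg)
  then have "ip H x z = ip H (x \<ominus> y) z + ip H y z"
    using assms ip_add[of "x \<ominus> y" y z] by simp
  then show ?thesis
    by simp
qed

lemma ip_zero: "z \<in> carrier H \<Longrightarrow> ip H \<zero> z = 0"
  using ip_smult[of z z 0] smult_l_null[of z] by simp

lemma ip_right:
  assumes "x \<in> carrier H" "y \<in> carrier H" "z \<in> carrier H"
  shows "ip H z (x \<oplus> y) = ip H z x + ip H z y"
    and "ip H z (x \<ominus> y) = ip H z x - ip H z y"
    and "ip H z (c \<odot> x) = cnj c * ip H z x"
  using assms ip_cnj[of "x \<oplus> y" z] ip_cnj[of "x \<ominus> y" z] ip_cnj[of "c \<odot> x" z]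
    ip_cnj[of x z] ip_cnj[of y z]
  by (simp_all add: ip_add ip_minus ip_smult)

lemma ip_zero_right: "z \<in> carrier H \<Longrightarrow> ip H z \<zero> = 0"
  using ip_cnj[of \<zero> z] by (simp add: ip_zero)

lemmas ip_simps = ip_add ip_minus ip_smult ip_right ip_zero ip_zero_right

lemma ip_self:
  assumes "x \<in> carrier H"
  shows "ip H x x = complex_of_real ((hnorm H x)\<^sup>2)"
proof -
  have "Im (ip H x x) = 0"
    using arg_cong[OF ip_cnj[OF assms assms], of Im] by simp
  then show ?thesis
    using ip_nonneg[OF assms] by (intro complex_eqI) (simp_all add: hnorm_def)
qed

lemma hnorm_nonneg: "x \<in> carrier H \<Longrightarrow> hnorm H x \<ge> 0"
  by (simp add: hnorm_def ip_nonneg)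

lemma hnorm_eq_0D: "\<lbrakk>x \<in> carrier H; hnorm H x = 0\<rbrakk> \<Longrightarrow> x = \<zero>"
  by (rule ip_definite) (simp_all add: ip_self)

lemma minus_eq_zeroD:
  assumes "x \<in> carrier H" "y \<in> carrier H" "x \<ominus> y = \<zero>"
  shows "x = y"
proof -
  have "(x \<ominus> y) \<oplus> y = x"
    using assms(1,2) by (simp add: M.minus_eq M.a_assoc M.l_neg)
  then show ?thesis
    using assms by simp
qed

text \<open>Testing against all vectors reduces every identity between vectors to one between
  complex numbers, which replaces calculations in the module.\<close>

lemma ip_eqI:
  assumes "x \<in> carrier H" "y \<in> carrier H"
    and "\<And>z. z \<in> carrier H \<Longrightarrow> ip H x z = ip H y z"
  shows "x = y"
proof (rule minus_eq_zeroD[OF assms(1,2)], rule ip_definite)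
  show "ip H (x \<ominus> y) (x \<ominus> y) = 0"
    using assms(1,2) assms(3)[of "x \<ominus> y"] by (simp add: ip_minus)
qed (use assms in simp)

lemma minus_conv_smult:
  "x \<in> carrier H \<Longrightarrow> y \<in> carrier H \<Longrightarrow> x \<ominus> y = x \<oplus> (- 1) \<odot> y"
  by (intro ip_eqI) (simp_all add: ip_simps)

lemma hnorm_diff_sq:
  assumes "x \<in> carrier H" "y \<in> carrier H"
  shows "(hnorm H (x \<ominus> y))\<^sup>2 = (hnorm H x)\<^sup>2 + (hnorm H y)\<^sup>2 - 2 * Re (ip H x y)"
proof -
  have "complex_of_real ((hnorm H (x \<ominus> y))\<^sup>2)
      = ip H x x + ip H y y - (ip H x y + cnj (ip H x y))"
    using assms by (simp add: ip_self[symmetric] ip_simps ip_cnj[of x y] del: of_real_power)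
  then have "complex_of_real ((hnorm H (x \<ominus> y))\<^sup>2)
      = complex_of_real ((hnorm H x)\<^sup>2 + (hnorm H y)\<^sup>2 - 2 * Re (ip H x y))"
    using assms by (simp add: ip_self complex_add_cnj)
  then show ?thesis
    by (simp only: of_real_eq_iff)
qed

lemma hnorm_smult: "x \<in> carrier H \<Longrightarrow> hnorm H (c \<odot> x) = cmod c * hnorm H x"
proof -
  assume x: "x \<in> carrier H"
  have "ip H (c \<odot> x) (c \<odot> x) = complex_of_real ((cmod c * hnorm H x)\<^sup>2)"
    using x by (simp add: ip_simps)
      (simp add: ip_self power_mult_distrib complex_norm_square[of c, simplified])
  then have "Re (ip H (c \<odot> x) (c \<odot> x)) = (cmod c * hnorm H x)\<^sup>2"
    by (metis Re_complex_of_real)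
  then show ?thesis
    using hnorm_nonneg[OF x] by (simp add: hnorm_def)
qed

text \<open>Subtracting from \<open>x\<close> its component along \<open>z\<close> shortens it by the expected amount; both the
  Cauchy-Schwarz inequality and the projection theorem are instances.\<close>

lemma hnorm_orthogonal_component:
  assumes "x \<in> carrier H" "z \<in> carrier H" "hnorm H z \<noteq> 0"
  defines "c \<equiv> ip H x z / complex_of_real ((hnorm H z)\<^sup>2)"
  shows "(hnorm H (x \<ominus> c \<odot> z))\<^sup>2 = (hnorm H x)\<^sup>2 - (cmod (ip H x z))\<^sup>2 / (hnorm H z)\<^sup>2"
proof -
  have "Re (ip H x (c \<odot> z)) = (cmod (ip H x z))\<^sup>2 / (hnorm H z)\<^sup>2"
  proof -
    have "ip H x (c \<odot> z) = complex_of_real ((cmod (ip H x z))\<^sup>2 / (hnorm H z)\<^sup>2)"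
      using assms(1,2)
      by (simp add: ip_simps c_def complex_norm_square[of "ip H x z", simplified])
    then show ?thesis by (metis Re_complex_of_real)
  qed
  moreover have "(hnorm H (c \<odot> z))\<^sup>2 = (cmod (ip H x z))\<^sup>2 / (hnorm H z)\<^sup>2"
    using assms(1-3) by (simp add: hnorm_smult c_def norm_divide norm_power power_divide power_mult_distrib)
      (simp add: power2_eq_square power4_eq_xxxx field_simps)
  ultimately show ?thesis
    using hnorm_diff_sq[of x "c \<odot> z"] assms(1,2) by simp
qed

lemma cauchy_schwarz:
  assumes "x \<in> carrier H" "z \<in> carrier H"
  shows "cmod (ip H x z) \<le> hnorm H x * hnorm H z"
proof (cases "hnorm H z = 0")
  case True
  then show ?thesis
    using assms hnorm_eq_0D[of z] by (simp add: ip_zero_right)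
next
  case False
  then have "(cmod (ip H x z))\<^sup>2 / (hnorm H z)\<^sup>2 \<le> (hnorm H x)\<^sup>2"
    using hnorm_orthogonal_component[OF assms False] by (smt (verit) zero_le_power2)
  then have "(cmod (ip H x z))\<^sup>2 \<le> (hnorm H x * hnorm H z)\<^sup>2"
    using False by (simp add: field_simps)
  then show ?thesis
    using hnorm_nonneg assms by (simp add: power2_le_iff_abs_le)
qed

lemma hnorm_minus_commute:
  assumes "x \<in> carrier H" "y \<in> carrier H"
  shows "hnorm H (x \<ominus> y) = hnorm H (y \<ominus> x)"
proof -
  have "(hnorm H (x \<ominus> y))\<^sup>2 = (hnorm H (y \<ominus> x))\<^sup>2"
    using assms by (simp add: hnorm_diff_sq ip_cnj[of x y])
  then show ?thesis
    using assms hnorm_nonneg by (simp add: power2_eq_iff_nonneg)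
qed

lemma hnorm_triangle:
  assumes "x \<in> carrier H" "y \<in> carrier H" "z \<in> carrier H"
  shows "hnorm H (x \<ominus> z) \<le> hnorm H (x \<ominus> y) + hnorm H (y \<ominus> z)"
proof -
  let ?a = "x \<ominus> y" and ?b = "z \<ominus> y"
  have "x \<ominus> z = ?a \<ominus> ?b"
    using assms by (intro ip_eqI) (simp_all add: ip_simps)
  then have "(hnorm H (x \<ominus> z))\<^sup>2 = (hnorm H ?a)\<^sup>2 + (hnorm H ?b)\<^sup>2 - 2 * Re (ip H ?a ?b)"
    using assms hnorm_diff_sq[of ?a ?b] by simp
  also have "\<dots> \<le> (hnorm H ?a + hnorm H ?b)\<^sup>2"
    using cauchy_schwarz[of ?a ?b] abs_Re_le_cmod[of "ip H ?a ?b"] assms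
    by (simp add: power2_sum)
  finally show ?thesis
    using assms hnorm_nonneg hnorm_minus_commute[of z y] by (simp add: power2_le_iff_abs_le)
qed

lemma hdist_eq: "\<lbrakk>x \<in> carrier H; y \<in> carrier H\<rbrakk> \<Longrightarrow> hdist H x y = hnorm H (x \<ominus> y)"
  by (simp add: hdist_def)

lemma Metric_space_hdist: "Metric_space (carrier H) (hdist H)"
proof
  fix x y z
  show "0 \<le> hdist H x y" "hdist H x y = hdist H y x"
    by (auto simp: hdist_def hnorm_nonneg hnorm_minus_commute)
  show "x \<in> carrier H \<Longrightarrow> y \<in> carrier H \<Longrightarrow> (hdist H x y = 0) = (x = y)"
    using hnorm_eq_0D[of "x \<ominus> y"] minus_eq_zeroD[of x y]
    by (auto simp: hdist_eq hnorm_def ip_simps)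
  show "x \<in> carrier H \<Longrightarrow> y \<in> carrier H \<Longrightarrow> z \<in> carrier H \<Longrightarrow> hdist H x z \<le> hdist H x y + hdist H y z"
    by (simp add: hdist_eq hnorm_triangle)
qed

sublocale HM: Metric_space "carrier H" "hdist H"
  by (rule Metric_space_hdist)

lemma ip_tendsto:
  assumes "limitin HM.mtopology f x sequentially" "\<And>n. f n \<in> carrier H" "z \<in> carrier H"
  shows "(\<lambda>n. ip H (f n) z) \<longlonglongrightarrow> ip H x z"
proof -
  have x: "x \<in> carrier H" and "(\<lambda>n. hdist H (f n) x) \<longlonglongrightarrow> 0"
    using assms(1) by (auto simp: HM.limitin_metric_dist_null)
  then have "(\<lambda>n. hdist H (f n) x * hnorm H z) \<longlonglongrightarrow> 0"
    using tendsto_mult_left_zero by blast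
  moreover have "cmod (ip H (f n) z - ip H x z) \<le> hdist H (f n) x * hnorm H z" for n
    using cauchy_schwarz[of "f n \<ominus> x" z] assms(2,3) x by (simp add: ip_simps hdist_eq)
  ultimately have "(\<lambda>n. ip H (f n) z - ip H x z) \<longlonglongrightarrow> 0"
    using Lim_null_comparison[of "\<lambda>n. ip H (f n) z - ip H x z"] by (metis (lifting) eventuallyI)
  then show ?thesis
    by (simp add: LIM_zero_iff)
qed

lemma continuous_map_ip:
  assumes "z \<in> carrier H"
  shows "continuous_map (htopology H) euclidean (\<lambda>x. ip H x z)"
    and "continuous_map (htopology H) euclidean (\<lambda>x. ip H z x)"
proof -
  show *: "continuous_map (htopology H) euclidean (\<lambda>x. ip H x z)"
    unfolding HM.continuous_map_from_metric
  proof (intro conjI ballI allI impI)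
    fix a U assume a: "a \<in> carrier H" and U: "openin euclidean U \<and> ip H a z \<in> U"
    then obtain e where e: "e > 0" "\<And>w. dist w (ip H a z) < e \<Longrightarrow> w \<in> U"
      by (auto simp: open_dist)
    have "ip H x z \<in> U" if x: "x \<in> carrier H" "hdist H a x < e / (hnorm H z + 1)" for x
    proof (rule e(2))
      have "cmod (ip H x z - ip H a z) \<le> hnorm H (x \<ominus> a) * hnorm H z"
        using cauchy_schwarz[of "x \<ominus> a" z] assms a x by (simp add: ip_simps)
      also have "\<dots> \<le> hdist H a x * (hnorm H z + 1)"
        using assms a x hnorm_nonneg[of z] hnorm_nonneg[of "x \<ominus> a"] hnorm_minus_commute[of x a]
        by (simp add: hdist_eq mult_left_mono)
      also have "\<dots> < e"
        using x(2) hnorm_nonneg[OF assms] by (simp add: pos_less_divide_eq)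
      finally show "dist (ip H x z) (ip H a z) < e"
        by (simp add: dist_norm)
    qed
    then show "\<exists>r>0. \<forall>x. x \<in> carrier H \<and> hdist H a x < r \<longrightarrow> ip H x z \<in> U"
      using e(1) hnorm_nonneg[OF assms] by (intro exI[of _ "e / (hnorm H z + 1)"]) auto
  qed simp
  have "continuous_map (htopology H) euclidean (\<lambda>x. cnj (ip H x z))"
    using continuous_map_compose[OF *, of euclidean cnj] by (simp add: o_def continuous_on_cnj)
  then show "continuous_map (htopology H) euclidean (\<lambda>x. ip H z x)"
    by (rule continuous_map_eq) (use assms in \<open>auto simp: ip_cnj[of _ z]\<close>)
qed

end

text \<open>The projection theorem, for a subspace \<open>Y\<close> that need not be closed. The vectors of a
  minimizing sequence are almost orthogonal to \<open>Y\<close> after subtraction from \<open>x\<close>, which makes the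
  sequence Cauchy and passes to its limit.\<close>

lemma (in complex_hilbert_space) projection:
  assumes Y: "Y \<subseteq> carrier H" "\<zero> \<in> Y" "\<And>y z. y \<in> Y \<Longrightarrow> z \<in> Y \<Longrightarrow> y \<oplus> z \<in> Y"
      "\<And>c y. y \<in> Y \<Longrightarrow> c \<odot> y \<in> Y"
    and x: "x \<in> carrier H"
  shows "\<exists>f y. range f \<subseteq> Y \<and> limitin (htopology H) f y sequentially \<and> y \<in> carrier H
    \<and> (\<forall>z\<in>Y. ip H (x \<ominus> y) z = 0)"
proof -
  have Yc: "y \<in> Y \<Longrightarrow> y \<in> carrier H" for y using Y(1) by auto
  have minusY: "y \<ominus> z \<in> Y" if "y \<in> Y" "z \<in> Y" for y z
    using Yc that Y by (simp add: minus_conv_smult)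
  define d where "d = (INF y\<in>Y. (hnorm H (x \<ominus> y))\<^sup>2)"
  have bdd: "bdd_below ((\<lambda>y. (hnorm H (x \<ominus> y))\<^sup>2) ` Y)"
    by (rule bdd_belowI[of _ 0]) auto
  have d_le: "d \<le> (hnorm H (x \<ominus> y))\<^sup>2" if "y \<in> Y" for y
    unfolding d_def by (rule cINF_lower[OF bdd that])
  have "\<exists>y\<in>Y. (hnorm H (x \<ominus> y))\<^sup>2 < d + (1 / (real n + 1))\<^sup>2" for n
  proof -
    have "d < d + (1 / (real n + 1))\<^sup>2" by simp
    then show ?thesis
      unfolding d_def using Y(2) bdd by (subst (asm) cINF_less_iff) auto
  qed
  then obtain f where f: "\<And>n. f n \<in> Y" "\<And>n. (hnorm H (x \<ominus> f n))\<^sup>2 < d + (1 / (real n + 1))\<^sup>2"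
    by metis
  note fc = Yc[OF f(1)]
  have orth: "cmod (ip H (x \<ominus> f n) z) \<le> hnorm H z * (1 / (real n + 1))" if z: "z \<in> Y" for n z
  proof (cases "hnorm H z = 0")
    case True
    then show ?thesis
      using Yc[OF z] x fc hnorm_eq_0D[of z] by (simp add: ip_zero_right)
  next
    case False
    let ?c = "ip H (x \<ominus> f n) z / complex_of_real ((hnorm H z)\<^sup>2)"
    have "(x \<ominus> f n) \<ominus> ?c \<odot> z = x \<ominus> (f n \<oplus> ?c \<odot> z)"
      using Yc z x fc by (intro ip_eqI) (simp_all add: ip_simps)
    then have "d \<le> (hnorm H ((x \<ominus> f n) \<ominus> ?c \<odot> z))\<^sup>2"
      using d_le[of "f n \<oplus> ?c \<odot> z"] Y z f(1) by simp
    also have "\<dots> = (hnorm H (x \<ominus> f n))\<^sup>2 - (cmod (ip H (x \<ominus> f n) z))\<^sup>2 / (hnorm H z)\<^sup>2"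
      using Yc z x fc False by (intro hnorm_orthogonal_component) simp_all
    finally have "(cmod (ip H (x \<ominus> f n) z))\<^sup>2 / (hnorm H z)\<^sup>2 \<le> (1 / (real n + 1))\<^sup>2"
      using f(2)[of n] by linarith
    then have "(cmod (ip H (x \<ominus> f n) z))\<^sup>2 \<le> (hnorm H z * (1 / (real n + 1)))\<^sup>2"
      using False by (simp add: power_divide divide_le_eq mult.commute)
    then show ?thesis
      using hnorm_nonneg[OF Yc[OF z]] by (simp add: power2_le_iff_abs_le)
  qed
  have close: "hnorm H (f n \<ominus> f m) \<le> 1 / (real n + 1) + 1 / (real m + 1)" for n m
  proof -
    let ?z = "f n \<ominus> f m"
    have z: "?z \<in> Y" using f(1) minusY by auto
    have "complex_of_real ((hnorm H ?z)\<^sup>2) = ip H (x \<ominus> f m) ?z - ip H (x \<ominus> f n) ?z"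
      using fc x by (simp add: ip_self[symmetric] ip_simps del: of_real_power)
    then have "(hnorm H ?z)\<^sup>2 = cmod (ip H (x \<ominus> f m) ?z - ip H (x \<ominus> f n) ?z)"
      by (metis norm_of_real abs_power2)
    also have "\<dots> \<le> hnorm H ?z * (1 / (real n + 1) + 1 / (real m + 1))"
      using norm_triangle_ineq4[of "ip H (x \<ominus> f m) ?z" "ip H (x \<ominus> f n) ?z"]
        orth[OF z, of n] orth[OF z, of m] unfolding distrib_left by linarith
    finally have "hnorm H ?z * hnorm H ?z \<le> hnorm H ?z * (1 / (real n + 1) + 1 / (real m + 1))"
      by (simp add: power2_eq_square)
    moreover have "hnorm H ?z \<ge> 0" using fc hnorm_nonneg by simp
    ultimately show ?thesis
      by (cases "hnorm H ?z = 0") (auto simp: mult_le_cancel_left)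
  qed
  have "HM.MCauchy f"
    unfolding HM.MCauchy_def
  proof (intro conjI allI impI)
    show "range f \<subseteq> carrier H" using fc by auto
    fix e :: real assume "e > 0"
    then obtain N where N: "inverse (real (Suc N)) < e / 2"
      using reals_Archimedean[of "e / 2"] by auto
    have "hdist H (f n) (f m) < e" if "N \<le> n" "N \<le> m" for n m
    proof -
      have *: "1 / (real k + 1) < e / 2" if "N \<le> k" for k
      proof -
        have "1 / (real k + 1) \<le> 1 / (real N + 1)"
          using that by (intro divide_left_mono) auto
        then show ?thesis using N by (simp add: inverse_eq_divide add.commute)
      qed
      show ?thesis
        using close[of n m] fc *[OF that(1)] *[OF that(2)] by (simp only: hdist_eq)
    qed
    then show "\<exists>N. \<forall>n n'. N \<le> n \<longrightarrow> N \<le> n' \<longrightarrow> hdist H (f n) (f n') < e" by blast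
  qed
  then obtain y where y: "limitin HM.mtopology f y sequentially"
    using complete by (auto simp: HM.mcomplete_def)
  then have yc: "y \<in> carrier H" by (simp add: HM.limitin_mspace)
  have "ip H (x \<ominus> y) z = 0" if z: "z \<in> Y" for z
  proof -
    have "(\<lambda>n. ip H x z - ip H (f n) z) \<longlonglongrightarrow> ip H x z - ip H y z"
      using ip_tendsto[OF y fc] Yc z by (intro tendsto_intros) auto
    then have "(\<lambda>n. ip H (x \<ominus> f n) z) \<longlonglongrightarrow> ip H (x \<ominus> y) z"
      using Yc z fc yc x by (simp add: ip_simps)
    moreover have "(\<lambda>n. ip H (x \<ominus> f n) z) \<longlonglongrightarrow> 0"
    proof (rule Lim_null_comparison)
      show "(\<lambda>n. hnorm H z * (1 / (real n + 1))) \<longlonglongrightarrow> 0"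
        using tendsto_mult_right[OF LIMSEQ_inverse_real_of_nat, of "hnorm H z"]
        by (simp add: inverse_eq_divide add.commute)
    qed (use orth[OF z] in simp)
    ultimately show ?thesis by (rule LIMSEQ_unique)
  qed
  then show ?thesis
    using y yc f(1) by blast
qed

section \<open>Self-adjoint operators and normal operators\<close>

context complex_inner_product_space
begin

text \<open>Membership in the adjoint is a family of equations between continuous functions of the pair.\<close>

lemma closed_adjoint:
  assumes A: "A \<subseteq> carrier H \<times> carrier H"
  shows "closed_operator H (adjoint_operator H A)"
proof -
  let ?T = "prod_topology (htopology H) (htopology H)"
  have top: "topspace ?T = carrier H \<times> carrier H" by simp
  define S where "S a = {p \<in> topspace ?T. ip H (snd a) (fst p) - ip H (fst a) (snd p) \<in> {0}}" for a
  have cl: "closedin ?T (S a)" if "a \<in> A" for a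
    unfolding S_def
  proof (rule closedin_continuous_map_preimage)
    have a: "fst a \<in> carrier H" "snd a \<in> carrier H" using A that by auto
    have "continuous_map ?T euclidean (\<lambda>p. ip H (snd a) (fst p))"
      using continuous_map_compose[OF continuous_map_fst continuous_map_ip(2)[OF a(2)]]
      by (simp add: o_def)
    moreover have "continuous_map ?T euclidean (\<lambda>p. ip H (fst a) (snd p))"
      using continuous_map_compose[OF continuous_map_snd continuous_map_ip(2)[OF a(1)]]
      by (simp add: o_def)
    ultimately show "continuous_map ?T euclidean (\<lambda>p. ip H (snd a) (fst p) - ip H (fst a) (snd p))"
      by (rule continuous_map_diff)
  qed simp
  have "adjoint_operator H A = topspace ?T \<inter> \<Inter> (S ` A)"
    unfolding top by (fastforce simp: adjoint_operator_def S_def)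
  then show ?thesis
    using cl closedin_topspace[of ?T] unfolding closed_operator_def
    by (cases "A = {}") (auto simp del: topspace_prod_topology intro!: closedin_Int)
qed

lemma hnorm_add_sq:
  assumes "x \<in> carrier H" "y \<in> carrier H"
  shows "(hnorm H (x \<oplus> y))\<^sup>2 = (hnorm H x)\<^sup>2 + (hnorm H y)\<^sup>2 + 2 * Re (ip H x y)"
proof -
  have "complex_of_real ((hnorm H (x \<oplus> y))\<^sup>2)
      = ip H x x + ip H y y + (ip H x y + cnj (ip H x y))"
    using assms by (simp add: ip_self[symmetric] ip_simps ip_cnj[of x y] del: of_real_power)
  then have "complex_of_real ((hnorm H (x \<oplus> y))\<^sup>2)
      = complex_of_real ((hnorm H x)\<^sup>2 + (hnorm H y)\<^sup>2 + 2 * Re (ip H x y))"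
    using assms by (simp add: ip_self complex_add_cnj)
  then show ?thesis
    by (simp only: of_real_eq_iff)
qed

text \<open>Polarization: the norms of sums determine the real part of the inner product, and replacing
  \<open>y\<close> by \<open>\<i> y\<close> gives the imaginary part.\<close>

lemma norm_preserving_imp_ip_preserving:
  assumes K: "complex_inner_product_space K"
    and T: "\<And>x. x \<in> carrier H \<Longrightarrow> T x \<in> carrier K"
      "\<And>x y. x \<in> carrier H \<Longrightarrow> y \<in> carrier H \<Longrightarrow> T (x \<oplus> y) = T x \<oplus>\<^bsub>K\<^esub> T y"
      "\<And>c x. x \<in> carrier H \<Longrightarrow> T (c \<odot> x) = c \<odot>\<^bsub>K\<^esub> T x"
      "\<And>x. x \<in> carrier H \<Longrightarrow> hnorm K (T x) = hnorm H x"
    and xy: "x \<in> carrier H" "y \<in> carrier H"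
  shows "ip K (T x) (T y) = ip H x y"
proof -
  interpret K: complex_inner_product_space K by fact
  have Re: "Re (ip K (T a) (T b)) = Re (ip H a b)" if "a \<in> carrier H" "b \<in> carrier H" for a b
    using hnorm_add_sq[OF that] K.hnorm_add_sq[OF T(1)[OF that(1)] T(1)[OF that(2)]] that
    by (simp add: T(2)[symmetric] T(4))
  have "Im (ip K (T x) (T y)) = Im (ip H x y)"
    using Re[OF xy(1), of "\<i> \<odot> y"] xy T(1)[OF xy(1)] T(1)[OF xy(2)]
    by (simp add: T(3) ip_simps K.ip_simps)
  then show ?thesis
    using Re[OF xy] by (rule complex_eqI[rotated])
qed

end

context complex_hilbert_space
begin

text \<open>By the projection theorem every vector differs from a limit of elements of \<open>Y\<close> by a vector
  orthogonal to \<open>Y\<close>.\<close>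

lemma dense_if_orthogonal_complement_trivial:
  assumes Y: "Y \<subseteq> carrier H" "\<zero> \<in> Y" "\<And>y z. y \<in> Y \<Longrightarrow> z \<in> Y \<Longrightarrow> y \<oplus> z \<in> Y"
      "\<And>c y. y \<in> Y \<Longrightarrow> c \<odot> y \<in> Y"
    and orth: "\<And>x. x \<in> carrier H \<Longrightarrow> (\<And>z. z \<in> Y \<Longrightarrow> ip H x z = 0) \<Longrightarrow> x = \<zero>"
  shows "htopology H closure_of Y = carrier H"
proof
  show "htopology H closure_of Y \<subseteq> carrier H"
    using closure_of_subset_topspace[of "htopology H" Y] by simp
  show "carrier H \<subseteq> htopology H closure_of Y"
  proof
    fix x assume x: "x \<in> carrier H"
    obtain f y where f: "range f \<subseteq> Y" "limitin (htopology H) f y sequentially"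
      and y: "y \<in> carrier H" "\<And>z. z \<in> Y \<Longrightarrow> ip H (x \<ominus> y) z = 0"
      using projection[OF Y x] by blast
    have "x = y"
      using orth[of "x \<ominus> y"] x y minus_eq_zeroD[OF x y(1)] by auto
    moreover have "y \<in> htopology H closure_of Y"
      using f y(1) Y(1) by (auto simp: HM.closure_of_sequentially intro!: exI[of _ f])
    ultimately show "x \<in> htopology H closure_of Y" by simp
  qed
qed

lemma densely_definedI:
  assumes A: "linear_operator H A"
    and orth: "\<And>x. x \<in> carrier H \<Longrightarrow> (\<And>z. z \<in> Domain A \<Longrightarrow> ip H x z = 0) \<Longrightarrow> x = \<zero>"
  shows "densely_defined H A"
  unfolding densely_defined_def
proof (rule dense_if_orthogonal_complement_trivial[OF _ _ _ _ orth])
  show "y \<oplus> z \<in> Domain A" if "y \<in> Domain A" "z \<in> Domain A" for y z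
    using A that unfolding linear_operator_def by blast
  show "c \<odot> y \<in> Domain A" if "y \<in> Domain A" for c y
    using A that unfolding linear_operator_def by blast
qed (use A in \<open>auto simp: linear_operator_def\<close>)

text \<open>The range of an isometry is closed by completeness, so every \<open>y\<close> has a projection \<open>U r\<close> onto
  it. This \<open>r\<close> is the value of the adjoint at \<open>y\<close>.\<close>

lemma isometry_adjoint_exists:
  assumes U: "\<And>x. x \<in> carrier H \<Longrightarrow> U x \<in> carrier H"
      "\<And>x y. x \<in> carrier H \<Longrightarrow> y \<in> carrier H \<Longrightarrow> U (x \<oplus> y) = U x \<oplus> U y"
      "\<And>c x. x \<in> carrier H \<Longrightarrow> U (c \<odot> x) = c \<odot> U x"
      "\<And>x y. x \<in> carrier H \<Longrightarrow> y \<in> carrier H \<Longrightarrow> ip H (U x) (U y) = ip H x y"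
  shows "\<exists>L. (\<forall>y \<in> carrier H. L y \<in> carrier H \<and>
    (\<forall>x \<in> carrier H. ip H (L y) x = ip H y (U x)))"
proof (rule bchoice, rule ballI)
  fix y assume y: "y \<in> carrier H"
  let ?Y = "U ` carrier H"
  have "U \<zero> = \<zero>"
    using U(1,4)[of \<zero>] by (intro ip_definite) (simp_all add: ip_zero)
  then have zero: "\<zero> \<in> ?Y" by (metis M.zero_closed imageI)
  have add: "a \<oplus> b \<in> ?Y" if "a \<in> ?Y" "b \<in> ?Y" for a b
    using that by (auto simp: U(2)[symmetric])
  have scale: "c \<odot> a \<in> ?Y" if "a \<in> ?Y" for a c
    using that by (auto simp: U(3)[symmetric])
  obtain f p where f: "range f \<subseteq> ?Y" "limitin (htopology H) f p sequentially"
    and p: "p \<in> carrier H" "\<And>z. z \<in> ?Y \<Longrightarrow> ip H (y \<ominus> p) z = 0"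
    using projection[OF _ zero add scale y] U(1) by blast
  have "\<forall>n. \<exists>q. q \<in> carrier H \<and> f n = U q" using f(1) by (auto simp: image_iff)
  then obtain q where q: "\<And>n. q n \<in> carrier H" "\<And>n. f n = U (q n)" by metis
  have dist: "hdist H (U a) (U b) = hdist H a b" if "a \<in> carrier H" "b \<in> carrier H" for a b
  proof -
    have "(hnorm H (U a \<ominus> U b))\<^sup>2 = (hnorm H (a \<ominus> b))\<^sup>2"
      using that U(1)[OF that(1)] U(1)[OF that(2)]
      by (simp add: hnorm_diff_sq U(4)) (simp add: hnorm_def U(4))
    then show ?thesis
      using that U(1) hnorm_nonneg by (simp add: hdist_eq power2_eq_iff_nonneg)
  qed
  have "HM.MCauchy f"
    using f U(1) by (intro HM.convergent_imp_MCauchy) auto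
  then have "HM.MCauchy q"
    using q dist by (simp add: HM.MCauchy_def image_subset_iff)
  then obtain r where r: "limitin HM.mtopology q r sequentially"
    using complete by (auto simp: HM.mcomplete_def)
  then have rc: "r \<in> carrier H" by (simp add: HM.limitin_mspace)
  have "limitin HM.mtopology f (U r) sequentially"
    using r q dist rc U(1) by (simp add: HM.limitin_metric_dist_null)
  then have "p = U r"
    using f(2) HM.limitin_metric_unique by (metis sequentially_bot)
  then have "ip H r x = ip H y (U x)" if "x \<in> carrier H" for x
    using p(2)[of "U x"] that y rc U(1) by (simp add: ip_simps U(4))
  then show "\<exists>l. l \<in> carrier H \<and> (\<forall>x \<in> carrier H. ip H l x = ip H y (U x))"
    using rc by blast
qed

text \<open>If the unitary \<open>V\<close> commutes with the self-adjoint \<open>M\<close>, then \<open>N = V M\<close> has the adjoint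
  \<open>M V\<^sup>*\<close>, and both products of \<open>N\<close> with it equal \<open>M\<^sup>2\<close>. Closedness comes for free because \<open>N\<close>
  is itself the adjoint of \<open>M V\<^sup>*\<close>; the domain is dense because a vector \<open>x\<close> orthogonal to it makes
  \<open>(0, x)\<close> a member of the adjoint of \<open>M\<close>, hence of \<open>M\<close>.\<close>

lemma normal_operator_unitary_selfadjoint:
  assumes M: "linear_operator H M" "adjoint_operator H M = M"
    and V: "\<And>x. x \<in> carrier H \<Longrightarrow> V x \<in> carrier H" "\<And>x. x \<in> carrier H \<Longrightarrow> V' x \<in> carrier H"
      "\<And>x. x \<in> carrier H \<Longrightarrow> V (V' x) = x" "\<And>x. x \<in> carrier H \<Longrightarrow> V' (V x) = x"
      "\<And>x y. x \<in> carrier H \<Longrightarrow> y \<in> carrier H \<Longrightarrow> ip H (V x) y = ip H x (V' y)"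
    and comm: "\<And>x y. (x, y) \<in> M \<Longrightarrow> (V x, V y) \<in> M" "\<And>x y. (x, y) \<in> M \<Longrightarrow> (V' x, V' y) \<in> M"
  shows "normal_operator H {(x, V y) | x y. (x, y) \<in> M}"
proof -
  define N where "N = {(x, V y) | x y. (x, y) \<in> M}"
  have Mc: "(x, y) \<in> M \<Longrightarrow> x \<in> carrier H \<and> y \<in> carrier H" for x y
    using M(1) by (auto simp: linear_operator_def)
  have ipV': "ip H x (V y) = ip H (V' x) y" if "x \<in> carrier H" "y \<in> carrier H" for x y
    using V(5)[of y x] that V(1,2) ip_cnj[of "V y" x] ip_cnj[of y "V' x"] by simp
  have adjM: "(g, h) \<in> M \<longleftrightarrow> g \<in> carrier H \<and> h \<in> carrier H \<and> (\<forall>(f, f') \<in> M. ip H f' g = ip H f h)" for g h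
    by (subst M(2)[symmetric]) (simp add: adjoint_operator_def)
  have adjN: "adjoint_operator H N = {(g, h). g \<in> carrier H \<and> (V' g, h) \<in> M}"
  proof (rule Set.set_eqI, simp only: split_paired_all)
    fix g h
    have "(g, h) \<in> adjoint_operator H N \<longleftrightarrow> g \<in> carrier H \<and> h \<in> carrier H \<and>
        (\<forall>(f, f') \<in> M. ip H (V f') g = ip H f h)"
      unfolding adjoint_operator_def N_def by blast
    also have "\<dots> \<longleftrightarrow> g \<in> carrier H \<and> h \<in> carrier H \<and>
        (\<forall>(f, f') \<in> M. ip H f' (V' g) = ip H f h)"
      using Mc V(5) by fastforce
    also have "\<dots> \<longleftrightarrow> (g, h) \<in> {(g, h). g \<in> carrier H \<and> (V' g, h) \<in> M}"
      by (auto simp: adjM[of "V' g" h] V(2))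
    finally show "(g, h) \<in> adjoint_operator H N \<longleftrightarrow> (g, h) \<in> {(g, h). g \<in> carrier H \<and> (V' g, h) \<in> M}" .
  qed
  have Vadd: "V (x \<oplus> y) = V x \<oplus> V y" "V (c \<odot> x) = c \<odot> V x"
    if "x \<in> carrier H" "y \<in> carrier H" for x y c
    using that V(1,2) by (intro ip_eqI; simp add: ip_simps V(5))+
  have Vzero: "V \<zero> = \<zero>"
    using V(1,2) by (intro ip_eqI) (simp_all add: ip_simps V(5))
  have lin: "linear_operator H N"
    unfolding linear_operator_def
  proof (intro conjI allI impI)
    show "N \<subseteq> carrier H \<times> carrier H" using Mc V(1) by (auto simp: N_def)
    show "single_valued N" using M(1) by (auto simp: N_def linear_operator_def single_valued_def)
    show "(\<zero>, \<zero>) \<in> N"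
      using M(1) Vzero by (force simp: N_def linear_operator_def)
    fix f f' assume f: "(f, f') \<in> N"
    then obtain k where k: "(f, k) \<in> M" "f' = V k" by (auto simp: N_def)
    show "(c \<odot> f, c \<odot> f') \<in> N" for c
      using k M(1) Mc[OF k(1)] Vadd(2)[of k k c] by (force simp: N_def linear_operator_def)
    fix g g' assume "(g, g') \<in> N"
    then obtain l where l: "(g, l) \<in> M" "g' = V l" by (auto simp: N_def)
    show "(f \<oplus> g, f' \<oplus> g') \<in> N"
      using k l M(1) Mc[OF k(1)] Mc[OF l(1)] Vadd(1)[of k l]
      by (force simp: N_def linear_operator_def)
  qed
  have dense: "densely_defined H N"
  proof (rule densely_definedI[OF lin])
    fix x assume x: "x \<in> carrier H" and orth: "\<And>z. z \<in> Domain N \<Longrightarrow> ip H x z = 0"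
    have ipM: "ip H f x = 0" if "(f, f') \<in> M" for f f'
      using orth[of f] Mc[OF that] x that ip_cnj[of x f] by (force simp: N_def)
    have "(\<zero>, x) \<in> M"
      by (rule adjM[THEN iffD2]) (use x Mc ipM in \<open>auto simp: ip_zero_right\<close>)
    then show "x = \<zero>"
      using M(1) by (auto simp: linear_operator_def single_valued_def)
  qed
  have "N = adjoint_operator H {(V x, y) | x y. (x, y) \<in> M}"
  proof -
    have "(p, q) \<in> adjoint_operator H {(V x, y) | x y. (x, y) \<in> M} \<longleftrightarrow> q \<in> carrier H \<and> (p, V' q) \<in> M" for p q
    proof -
      have "(p, q) \<in> adjoint_operator H {(V x, y) | x y. (x, y) \<in> M} \<longleftrightarrow>
         p \<in> carrier H \<and> q \<in> carrier H \<and> (\<forall>(f, f') \<in> M. ip H f' p = ip H (V f) q)"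
        unfolding adjoint_operator_def by blast
      moreover have "(\<forall>(f, f') \<in> M. ip H f' p = ip H (V f) q) \<longleftrightarrow>
          (\<forall>(f, f') \<in> M. ip H f' p = ip H f (V' q))" if "q \<in> carrier H"
        using that Mc V(5) by fastforce
      ultimately show ?thesis using adjM V(2) by auto
    qed
    moreover have "(p, q) \<in> N \<longleftrightarrow> q \<in> carrier H \<and> (p, V' q) \<in> M" for p q
      unfolding N_def using V Mc by (auto, metis)
    ultimately show ?thesis by auto
  qed
  then have closed: "closed_operator H N"
    using closed_adjoint[of "{(V x, y) | x y. (x, y) \<in> M}"] Mc V(1) by fastforce
  have "N O adjoint_operator H N = M O M"
    unfolding adjN using V Mc by (auto simp: N_def relcomp_unfold)
  moreover have "adjoint_operator H N O N = M O M"
  proof (rule Set.set_eqI, simp only: split_paired_all)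
    fix x z
    have "(x, z) \<in> M O M" if g: "x \<in> carrier H" "(V' x, h) \<in> M" "(h, y) \<in> M" "z = V y" for h y
      using comm(1)[OF g(2)] comm(1)[OF g(3)] V(3)[OF g(1)] g(4) by auto
    moreover have "x \<in> carrier H \<and> (V' x, V' y) \<in> M \<and> (V' y, V' z) \<in> M \<and> z = V (V' z)"
      if "(x, y) \<in> M" "(y, z) \<in> M" for y
      using that comm(2) V(3) Mc by auto
    moreover have "(x, z) \<in> adjoint_operator H N O N \<longleftrightarrow>
        x \<in> carrier H \<and> (\<exists>h y. (V' x, h) \<in> M \<and> (h, y) \<in> M \<and> z = V y)"
      unfolding adjN unfolding N_def relcomp_unfold by blast
    ultimately show "(x, z) \<in> adjoint_operator H N O N \<longleftrightarrow> (x, z) \<in> M O M"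
      by blast
  qed
  ultimately show ?thesis
    using lin dense closed unfolding normal_operator_def N_def by simp
qed

end

section \<open>Orthogonal sums and unitary dilation\<close>

text \<open>Pairs of vectors from \<open>nat \<Rightarrow> 'a\<close> are coded in the same type, so that the sum of two copies
  of a space has elements of the type of the space.\<close>

definition interleave :: "(nat \<Rightarrow> 'a) \<Rightarrow> (nat \<Rightarrow> 'a) \<Rightarrow> nat \<Rightarrow> 'a" where
  "interleave x y n = (if even n then x (n div 2) else y (n div 2))"

definition evens :: "(nat \<Rightarrow> 'a) \<Rightarrow> nat \<Rightarrow> 'a" where
  "evens z n = z (2 * n)"

definition odds :: "(nat \<Rightarrow> 'a) \<Rightarrow> nat \<Rightarrow> 'a" where
  "odds z n = z (Suc (2 * n))"

lemma interleave_simps [simp]: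
  "evens (interleave x y) = x" "odds (interleave x y) = y" "interleave (evens z) (odds z) = z"
  by (auto simp: interleave_def evens_def odds_def fun_eq_iff)

lemma interleave_eqI: "evens z = evens w \<Longrightarrow> odds z = odds w \<Longrightarrow> z = w"
  by (metis interleave_simps(3))

definition double :: "(nat \<Rightarrow> 'a) inner_space \<Rightarrow> (nat \<Rightarrow> 'a) inner_space" where
  "double H = \<lparr>carrier = {z. evens z \<in> carrier H \<and> odds z \<in> carrier H},
     monoid.mult = undefined, one = undefined,
     ring.zero = interleave \<zero>\<^bsub>H\<^esub> \<zero>\<^bsub>H\<^esub>,
     add = (\<lambda>z w. interleave (evens z \<oplus>\<^bsub>H\<^esub> evens w) (odds z \<oplus>\<^bsub>H\<^esub> odds w)),
     smult = (\<lambda>c z. interleave (c \<odot>\<^bsub>H\<^esub> evens z) (c \<odot>\<^bsub>H\<^esub> odds z)),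
     ip = (\<lambda>z w. ip H (evens z) (evens w) + ip H (odds z) (odds w))\<rparr>"

lemma double_simps [simp]:
  "z \<in> carrier (double H) \<longleftrightarrow> evens z \<in> carrier H \<and> odds z \<in> carrier H"
  "\<zero>\<^bsub>double H\<^esub> = interleave \<zero>\<^bsub>H\<^esub> \<zero>\<^bsub>H\<^esub>"
  "z \<oplus>\<^bsub>double H\<^esub> w = interleave (evens z \<oplus>\<^bsub>H\<^esub> evens w) (odds z \<oplus>\<^bsub>H\<^esub> odds w)"
  "c \<odot>\<^bsub>double H\<^esub> z = interleave (c \<odot>\<^bsub>H\<^esub> evens z) (c \<odot>\<^bsub>H\<^esub> odds z)"
  "ip (double H) z w = ip H (evens z) (evens w) + ip H (odds z) (odds w)"
  by (simp_all add: double_def)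

lemma complex_inner_product_space_double:
  fixes H :: "(nat \<Rightarrow> 'a) inner_space" (structure)
  assumes "complex_inner_product_space H"
  shows "complex_inner_product_space (double H)"
proof -
  interpret complex_inner_product_space H by fact
  have "abelian_group (double H)"
  proof (rule abelian_groupI)
    fix z assume "z \<in> carrier (double H)"
    then show "\<exists>w\<in>carrier (double H). w \<oplus>\<^bsub>double H\<^esub> z = \<zero>\<^bsub>double H\<^esub>"
      by (intro bexI[of _ "interleave (\<ominus> evens z) (\<ominus> odds z)"]) (auto simp: M.l_neg)
  qed (auto simp: M.a_ac)
  then have mod: "module complex_ring (double H)"
    using smult_l_distr smult_r_distr smult_assoc1 smult_one
    by (intro moduleI cring_complex_ring) auto
  show ?thesis
  proof (intro complex_inner_product_space.intro complex_inner_product_space_axioms.intro mod)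
    fix x assume x: "x \<in> carrier (double H)"
    show "0 \<le> Re (ip (double H) x x)"
      using x ip_nonneg by simp
    assume "ip (double H) x x = 0"
    then have "complex_of_real ((hnorm H (evens x))\<^sup>2 + (hnorm H (odds x))\<^sup>2) = 0"
      using x by (simp add: ip_self)
    then have "(hnorm H (evens x))\<^sup>2 + (hnorm H (odds x))\<^sup>2 = 0"
      by (simp only: of_real_eq_0_iff)
    then have "evens x = \<zero>" "odds x = \<zero>"
      using x hnorm_eq_0D[of "evens x"] hnorm_eq_0D[of "odds x"]
      by (auto simp: sum_power2_eq_zero_iff)
    then show "x = \<zero>\<^bsub>double H\<^esub>"
      using interleave_simps(3)[of x] by simp
  next
    fix x y assume "x \<in> carrier (double H)" "y \<in> carrier (double H)"
    then show "ip (double H) y x = cnj (ip (double H) x y)"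
      using ip_cnj[of "evens x" "evens y"] ip_cnj[of "odds x" "odds y"] by simp
  qed (auto simp: ip_simps algebra_simps)
qed

lemma complex_hilbert_space_double:
  fixes H :: "(nat \<Rightarrow> 'a) inner_space" (structure)
  assumes "complex_hilbert_space H"
  shows "complex_hilbert_space (double H)"
proof -
  interpret complex_hilbert_space H by fact
  interpret D: complex_inner_product_space "double H"
    by (rule complex_inner_product_space_double) unfold_locales
  have norm: "(hnorm (double H) z)\<^sup>2 = (hnorm H (evens z))\<^sup>2 + (hnorm H (odds z))\<^sup>2"
    if "z \<in> carrier (double H)" for z
    using that ip_nonneg by (simp add: hnorm_def)
  have dist: "(hdist (double H) z w)\<^sup>2 = (hdist H (evens z) (evens w))\<^sup>2 + (hdist H (odds z) (odds w))\<^sup>2"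
    if "z \<in> carrier (double H)" "w \<in> carrier (double H)" for z w
  proof -
    have "z \<ominus>\<^bsub>double H\<^esub> w = interleave (evens z \<ominus> evens w) (odds z \<ominus> odds w)"
      using that by (simp add: D.minus_conv_smult minus_conv_smult)
    then show ?thesis
      using that norm[of "z \<ominus>\<^bsub>double H\<^esub> w"] by (simp add: hdist_def)
  qed
  have "D.HM.mcomplete"
    unfolding D.HM.mcomplete_def
  proof (intro allI impI)
    fix f assume f: "D.HM.MCauchy f"
    then have fc: "\<And>n. f n \<in> carrier (double H)" by (auto simp: D.HM.MCauchy_def simp del: double_simps)
    have le: "hdist H (evens (f n)) (evens (f m)) \<le> hdist (double H) (f n) (f m)"
      "hdist H (odds (f n)) (odds (f m)) \<le> hdist (double H) (f n) (f m)" for n m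
      by (rule power2_le_imp_le; simp add: dist[OF fc fc])+
    have "HM.MCauchy (\<lambda>n. evens (f n))" "HM.MCauchy (\<lambda>n. odds (f n))"
      using f fc unfolding HM.MCauchy_def D.HM.MCauchy_def
      by (simp_all add: image_subset_iff) (meson le le_less_trans)+
    then obtain x y where x: "limitin HM.mtopology (\<lambda>n. evens (f n)) x sequentially"
      and y: "limitin HM.mtopology (\<lambda>n. odds (f n)) y sequentially"
      using complete unfolding HM.mcomplete_def by blast
    then have c: "x \<in> carrier H" "y \<in> carrier H" by (simp_all add: HM.limitin_mspace)
    have "(\<lambda>n. sqrt ((hdist H (evens (f n)) x)\<^sup>2 + (hdist H (odds (f n)) y)\<^sup>2)) \<longlonglongrightarrow> sqrt (0\<^sup>2 + 0\<^sup>2)"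
      using x y by (intro tendsto_intros) (auto simp: HM.limitin_metric_dist_null)
    moreover have "hdist (double H) (f n) (interleave x y)
        = sqrt ((hdist H (evens (f n)) x)\<^sup>2 + (hdist H (odds (f n)) y)\<^sup>2)" for n
      using dist[OF fc, of "interleave x y" n] c by (intro real_sqrt_unique[symmetric]) auto
    ultimately have "limitin D.HM.mtopology f (interleave x y) sequentially"
      using fc c by (simp add: D.HM.limitin_metric_dist_null)
    then show "\<exists>z. limitin D.HM.mtopology f z sequentially" by blast
  qed
  then show ?thesis
    by unfold_locales
qed

text \<open>The block matrix with rows \<open>(U, 1 - U U\<^sup>*)\<close> and \<open>(0, U\<^sup>*)\<close> is unitary and extends the
  isometry \<open>U\<close>. It commutes with two copies of a self-adjoint operator \<open>M\<close> as soon as \<open>U\<close>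
  commutes with \<open>M\<close>, so its product with them is a normal extension of \<open>U M\<close>.\<close>

theorem isometry_selfadjoint_normal_extension:
  fixes H :: "(nat \<Rightarrow> 'a) inner_space" (structure)
  assumes H: "complex_hilbert_space H"
    and M: "linear_operator H M" "adjoint_operator H M = M"
    and U: "\<And>x. x \<in> carrier H \<Longrightarrow> U x \<in> carrier H"
      "\<And>x y. x \<in> carrier H \<Longrightarrow> y \<in> carrier H \<Longrightarrow> U (x \<oplus> y) = U x \<oplus> U y"
      "\<And>c x. x \<in> carrier H \<Longrightarrow> U (c \<odot> x) = c \<odot> U x"
      "\<And>x. x \<in> carrier H \<Longrightarrow> hnorm H (U x) = hnorm H x"
    and comm: "\<And>x y. (x, y) \<in> M \<Longrightarrow> (U x, U y) \<in> M"
  shows "\<exists>N. normal_operator (double H) N \<and>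
    (\<forall>(x, y) \<in> M. (interleave x \<zero>, interleave (U y) \<zero>) \<in> N)"
proof -
  interpret complex_hilbert_space H by fact
  interpret D: complex_hilbert_space "double H"
    by (rule complex_hilbert_space_double) fact
  have Uip: "ip H (U x) (U y) = ip H x y" if "x \<in> carrier H" "y \<in> carrier H" for x y
    by (rule norm_preserving_imp_ip_preserving[OF complex_inner_product_space_axioms U that])
  \<comment> \<open>\<open>L\<close> is the adjoint of \<open>U\<close>; it commutes with \<open>M\<close> because \<open>U\<close> does and \<open>M\<close> is self-adjoint.\<close>
  obtain L where L: "\<And>y. y \<in> carrier H \<Longrightarrow> L y \<in> carrier H"
    "\<And>x y. x \<in> carrier H \<Longrightarrow> y \<in> carrier H \<Longrightarrow> ip H (L y) x = ip H y (U x)"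
    using isometry_adjoint_exists[OF U(1-3) Uip] by (metis (no_types))
  have L': "ip H (U x) y = ip H x (L y)" if "x \<in> carrier H" "y \<in> carrier H" for x y
    using L(2)[OF that] ip_cnj[of "L y" x] ip_cnj[of y "U x"] that L(1) U(1) by simp
  have Mc: "(x, y) \<in> M \<Longrightarrow> x \<in> carrier H \<and> y \<in> carrier H" for x y
    using M(1) by (auto simp: linear_operator_def)
  have adjM: "(g, h) \<in> M \<longleftrightarrow> g \<in> carrier H \<and> h \<in> carrier H \<and> (\<forall>(f, f') \<in> M. ip H f' g = ip H f h)" for g h
    by (subst M(2)[symmetric]) (simp add: adjoint_operator_def)
  have Msym: "ip H f' g = ip H f h" if "(f, f') \<in> M" "(g, h) \<in> M" for f f' g h
    using that(1) adjM[THEN iffD1, OF that(2)] by blast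
  have M0: "(\<zero>, \<zero>) \<in> M"
    using M(1) by (simp add: linear_operator_def)
  have Madd: "(a \<oplus> c, b \<oplus> d) \<in> M" if "(a, b) \<in> M" "(c, d) \<in> M" for a b c d
    using M(1) that by (simp add: linear_operator_def)
  have Mscale: "(k \<odot> a, k \<odot> b) \<in> M" if "(a, b) \<in> M" for a b k
    using M(1) that by (simp add: linear_operator_def)
  have Mminus: "(a \<ominus> c, b \<ominus> d) \<in> M" if "(a, b) \<in> M" "(c, d) \<in> M" for a b c d
    using Madd[OF that(1) Mscale[OF that(2), of "- 1"]] Mc[OF that(1)] Mc[OF that(2)]
    by (simp add: minus_conv_smult)
  have commL: "(L y, L y') \<in> M" if y: "(y, y') \<in> M" for y y'
    unfolding adjM
  proof (intro conjI ballI, safe)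
    fix f f' assume f: "(f, f') \<in> M"
    show "ip H f' (L y) = ip H f (L y')"
      using Mc[OF f] Mc[OF y] Msym[OF comm[OF f] y] by (simp add: L')
  qed (use Mc[OF y] L in auto)
  define M2 where "M2 = {(a, b). (evens a, evens b) \<in> M \<and> (odds a, odds b) \<in> M}"
  \<comment> \<open>the block matrix and its inverse\<close>
  define V where "V z = interleave (U (evens z) \<oplus> (odds z \<ominus> U (L (odds z)))) (L (odds z))" for z
  define V' where "V' z = interleave (L (evens z)) ((evens z \<ominus> U (L (evens z))) \<oplus> U (odds z))" for z
  have L1: "L (U x \<oplus> (y \<ominus> U (L y))) = x" if "x \<in> carrier H" "y \<in> carrier H" for x y
    using that U(1) L(1) by (intro ip_eqI) (simp_all add: L(2) ip_simps Uip)
  have L2: "L ((y \<ominus> U (L y)) \<oplus> U x) = x" if "x \<in> carrier H" "y \<in> carrier H" for x y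
    using L1[OF that] that U(1) L(1) by (simp add: M.a_comm)
  have "normal_operator (double H) {(x, V y) | x y. (x, y) \<in> M2}"
  proof (rule D.normal_operator_unitary_selfadjoint)
    show "linear_operator (double H) M2"
      unfolding linear_operator_def
    proof (intro conjI allI impI)
      show "single_valued M2"
      proof (rule single_valuedI)
        fix a b c assume "(a, b) \<in> M2" "(a, c) \<in> M2"
        then show "b = c"
          using M(1) interleave_eqI[of b c]
          by (auto simp: linear_operator_def M2_def single_valued_def)
      qed
    qed (use Mc M0 Madd Mscale in \<open>auto simp: M2_def\<close>)
    show "adjoint_operator (double H) M2 = M2"
    proof (rule Set.set_eqI, simp only: split_paired_all)
      fix g h
      have "(g, h) \<in> M2" if gh: "g \<in> carrier (double H)" "h \<in> carrier (double H)"
        and adj: "\<And>f f'. (f, f') \<in> M2 \<Longrightarrow> ip (double H) f' g = ip (double H) f h"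
      proof -
        have "ip H f' (evens g) = ip H f (evens h)" "ip H f' (odds g) = ip H f (odds h)"
          if "(f, f') \<in> M" for f f'
          using adj[of "interleave f \<zero>" "interleave f' \<zero>"] adj[of "interleave \<zero> f" "interleave \<zero> f'"]
            that M0 gh by (auto simp: M2_def ip_simps)
        then show ?thesis
          using gh by (auto simp: M2_def intro!: adjM[THEN iffD2])
      qed
      moreover have "ip (double H) f' g = ip (double H) f h"
        if "(f, f') \<in> M2" "(g, h) \<in> M2" for f f'
        using that Msym[of "evens f" "evens f'" "evens g" "evens h"]
          Msym[of "odds f" "odds f'" "odds g" "odds h"] by (simp add: M2_def)
      ultimately show "(g, h) \<in> adjoint_operator (double H) M2 \<longleftrightarrow> (g, h) \<in> M2"
        using Mc unfolding adjoint_operator_def by (auto simp: M2_def)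
    qed
    fix z w assume z: "z \<in> carrier (double H)"
    show "V z \<in> carrier (double H)" "V' z \<in> carrier (double H)"
      using z U(1) L(1) by (auto simp: V_def V'_def)
    show "V (V' z) = z"
    proof (rule interleave_eqI)
      show "odds (V (V' z)) = odds z"
        using z L2 by (simp add: V_def V'_def)
      show "evens (V (V' z)) = evens z"
        using z U(1) L(1) unfolding V_def V'_def interleave_simps
        by (subst L2, simp, simp, intro ip_eqI) (simp_all add: ip_simps)
    qed
    show "V' (V z) = z"
    proof (rule interleave_eqI)
      show "evens (V' (V z)) = evens z"
        using z L1 by (simp add: V_def V'_def)
      show "odds (V' (V z)) = odds z"
        using z U(1) L(1) unfolding V_def V'_def interleave_simps
        by (subst L1, simp, simp, intro ip_eqI) (simp_all add: ip_simps)
    qed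
    show "ip (double H) (V z) w = ip (double H) z (V' w)" if "w \<in> carrier (double H)"
      using z that U(1) L(1)
      by (simp add: V_def V'_def ip_simps L' L(2)[symmetric] del: L(2))
  next
    fix x y assume "(x, y) \<in> M2"
    then show "(V x, V y) \<in> M2" "(V' x, V' y) \<in> M2"
      using comm commL Madd Mminus by (auto simp: M2_def V_def V'_def)
  qed
  moreover have "(interleave x \<zero>, interleave (U y) \<zero>) \<in> {(x, V y) | x y. (x, y) \<in> M2}"
    if "(x, y) \<in> M" for x y
  proof -
    have "L \<zero> = \<zero>"
      using U(1) L(1) by (intro ip_eqI) (simp_all add: L(2) ip_simps)
    moreover have "U \<zero> = \<zero>"
      using U(1) L(1) by (intro ip_eqI) (simp_all add: L' ip_simps)
    ultimately have "V (interleave y \<zero>) = interleave (U y) \<zero>"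
      using Mc[OF that] U(1) by (simp add: V_def minus_conv_smult)
    moreover have "(interleave x \<zero>, interleave y \<zero>) \<in> M2"
      using that M0 by (simp add: M2_def)
    ultimately show ?thesis
      by (metis (mono_tags, lifting) mem_Collect_eq)
  qed
  ultimately show ?thesis by blast
qed

section \<open>Square integrable functions as a Hilbert space\<close>

lemma cnj_measurable [measurable]: "cnj \<in> borel_measurable borel"
  by (intro borel_measurable_continuous_onI continuous_intros)

definition L2 :: "'x measure \<Rightarrow> ('x \<Rightarrow> complex) set" where
  "L2 M = {f \<in> borel_measurable M. integrable M (\<lambda>x. (cmod (f x))\<^sup>2)}"

lemma L2_measurable [measurable_dest]: "f \<in> L2 M \<Longrightarrow> f \<in> borel_measurable M"
  by (simp add: L2_def)

lemma L2_iff: "f \<in> L2 M \<longleftrightarrow> f \<in> borel_measurable M \<and> (\<integral>\<^sup>+x. ennreal ((cmod (f x))\<^sup>2) \<partial>M) < \<infinity>"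
  by (auto simp: L2_def integrable_iff_bounded)

lemma L2_zero: "(\<lambda>x. 0) \<in> L2 M"
  by (simp add: L2_def)

lemma L2_smult: "f \<in> L2 M \<Longrightarrow> (\<lambda>x. a * f x) \<in> L2 M"
  by (auto simp: L2_def norm_mult power_mult_distrib)

lemma L2_bound:
  assumes "f \<in> L2 M" "g \<in> borel_measurable M" "AE x in M. cmod (g x) \<le> cmod (f x)"
  shows "g \<in> L2 M"
  using assms unfolding L2_def
  by (auto intro!: Bochner_Integration.integrable_bound[of M "\<lambda>x. (cmod (f x))\<^sup>2"] power_mono)

lemma L2_add:
  assumes "f \<in> L2 M" "g \<in> L2 M"
  shows "(\<lambda>x. f x + g x) \<in> L2 M"
proof -
  have [measurable]: "f \<in> borel_measurable M" "g \<in> borel_measurable M"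
    using assms by (simp_all add: L2_def)
  have "(cmod (f x + g x))\<^sup>2 \<le> 2 * (cmod (f x))\<^sup>2 + 2 * (cmod (g x))\<^sup>2" for x
  proof -
    have "(cmod (f x + g x))\<^sup>2 \<le> (cmod (f x) + cmod (g x))\<^sup>2"
      by (intro power_mono norm_triangle_ineq) simp
    also have "\<dots> \<le> 2 * (cmod (f x))\<^sup>2 + 2 * (cmod (g x))\<^sup>2"
      using sum_squares_bound[of "cmod (f x)" "cmod (g x)"] by (simp add: power2_sum)
    finally show ?thesis .
  qed
  moreover have "integrable M (\<lambda>x. 2 * (cmod (f x))\<^sup>2 + 2 * (cmod (g x))\<^sup>2)"
    using assms by (auto simp: L2_def)
  ultimately show ?thesis
    unfolding L2_def
    by (auto intro!: Bochner_Integration.integrable_bound[of M "\<lambda>x. 2 * (cmod (f x))\<^sup>2 + 2 * (cmod (g x))\<^sup>2"])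
qed

lemma L2_diff: "f \<in> L2 M \<Longrightarrow> g \<in> L2 M \<Longrightarrow> (\<lambda>x. f x - g x) \<in> L2 M"
  using L2_add[of f M "\<lambda>x. (- 1) * g x"] L2_smult[of g M "- 1"] by simp

lemma L2_mult_integrable:
  assumes "f \<in> L2 M" "g \<in> L2 M"
  shows "integrable M (\<lambda>x. f x * cnj (g x))"
proof -
  have [measurable]: "f \<in> borel_measurable M" "g \<in> borel_measurable M"
    using assms by (simp_all add: L2_def)
  have "integrable M (\<lambda>x. (cmod (f x))\<^sup>2 + (cmod (g x))\<^sup>2)"
    using assms by (auto simp: L2_def)
  moreover have "cmod (f x) * cmod (g x) \<le> (cmod (f x))\<^sup>2 + (cmod (g x))\<^sup>2" for x
  proof -
    have "0 \<le> cmod (f x) * cmod (g x)" by simp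
    then show ?thesis
      using sum_squares_bound[of "cmod (f x)" "cmod (g x)"] unfolding mult.assoc by linarith
  qed
  ultimately show ?thesis
    by (elim Bochner_Integration.integrable_bound) (simp_all add: norm_mult)
qed

text \<open>Rather than forming a quotient, square integrable functions are named by elements of an
  arbitrary type in such a way that functions equal almost everywhere share their name. This
  covers both the sequence spaces, where names are functions on the index set, and spaces whose
  vectors are coded by countably many numbers.\<close>

locale L2_model =
  fixes M :: "'x measure" and H :: "'b inner_space" (structure) and name :: "('x \<Rightarrow> complex) \<Rightarrow> 'b"
  assumes carrier_eq: "carrier H = name ` L2 M"
    and name_cong: "\<lbrakk>f \<in> L2 M; g \<in> L2 M; AE x in M. f x = g x\<rbrakk> \<Longrightarrow> name f = name g"
    and zero_eq: "\<zero> = name (\<lambda>x. 0)"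
    and add_eq: "\<lbrakk>f \<in> L2 M; g \<in> L2 M\<rbrakk> \<Longrightarrow> name f \<oplus> name g = name (\<lambda>x. f x + g x)"
    and smult_eq: "f \<in> L2 M \<Longrightarrow> a \<odot> name f = name (\<lambda>x. a * f x)"
    and ip_eq: "\<lbrakk>f \<in> L2 M; g \<in> L2 M\<rbrakk> \<Longrightarrow> ip H (name f) (name g) = (\<integral>x. f x * cnj (g x) \<partial>M)"
begin

lemma ip_self_eq:
  assumes "f \<in> L2 M"
  shows "ip H (name f) (name f) = complex_of_real (\<integral>x. (cmod (f x))\<^sup>2 \<partial>M)"
  using assms
  by (simp add: ip_eq complex_norm_square integral_complex_of_real[symmetric]
      del: of_real_power integral_complex_of_real)

lemma ip_self_eq_0_imp_AE:
  assumes f: "f \<in> L2 M" and "ip H (name f) (name f) = 0"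
  shows "AE x in M. f x = 0"
proof -
  have "(\<integral>x. (cmod (f x))\<^sup>2 \<partial>M) = 0"
    using assms ip_self_eq by simp
  then show ?thesis
    using f by (subst (asm) integral_nonneg_eq_0_iff_AE) (auto simp: L2_def)
qed

sublocale complex_inner_product_space H
proof (intro complex_inner_product_space.intro complex_inner_product_space_axioms.intro moduleI
    cring_complex_ring abelian_groupI)
  fix x assume "x \<in> carrier H"
  then obtain f where f: "f \<in> L2 M" "x = name f" by (auto simp: carrier_eq)
  show "\<exists>y\<in>carrier H. y \<oplus> x = \<zero>"
    using f L2_smult[OF f(1), of "- 1"]
    by (intro bexI[of _ "name (\<lambda>x. (- 1) * f x)"]) (auto simp: carrier_eq add_eq zero_eq)
  show "0 \<le> Re (ip H x x)"
    using f by (simp add: ip_self_eq)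
  show "x = \<zero>" if "ip H x x = 0"
    using that f ip_self_eq_0_imp_AE[OF f(1)] unfolding zero_eq f(2)
    by (intro name_cong) (auto simp: L2_zero)
next
  fix x y assume "x \<in> carrier H" "y \<in> carrier H"
  then obtain f g where f: "f \<in> L2 M" "x = name f" and g: "g \<in> L2 M" "y = name g"
    by (auto simp: carrier_eq)
  show "ip H y x = cnj (ip H x y)"
    using f g by (simp add: ip_eq) (subst Bochner_Integration.integral_cnj[symmetric], simp add: mult.commute)
next
  fix x y z assume "x \<in> carrier H" "y \<in> carrier H" "z \<in> carrier H"
  then obtain f g h where f: "f \<in> L2 M" "x = name f" and g: "g \<in> L2 M" "y = name g"
    and h: "h \<in> L2 M" "z = name h"
    by (auto simp: carrier_eq)
  show "ip H (x \<oplus> y) z = ip H x z + ip H y z"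
    using f g h by (simp add: ip_eq add_eq L2_add distrib_right L2_mult_integrable)
qed (auto simp: carrier_eq add_eq smult_eq zero_eq ip_eq L2_add L2_smult L2_zero algebra_simps)

lemma name_mem: "f \<in> L2 M \<Longrightarrow> name f \<in> carrier H"
  by (simp add: carrier_eq)

lemma name_diff: "f \<in> L2 M \<Longrightarrow> g \<in> L2 M \<Longrightarrow> name f \<ominus> name g = name (\<lambda>x. f x - g x)"
  using L2_smult[of g M "- 1"] by (simp add: minus_conv_smult name_mem add_eq smult_eq)

lemma name_eq_iff: "f \<in> L2 M \<Longrightarrow> g \<in> L2 M \<Longrightarrow> name f = name g \<longleftrightarrow> (AE x in M. f x = g x)"
  using name_cong[of f g] name_diff[of f g] ip_self_eq_0_imp_AE[OF L2_diff, of f g]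
    ip_zero[of \<zero>] by (auto simp: name_mem M.minus_eq M.r_neg)

lemma hnorm_name: "f \<in> L2 M \<Longrightarrow> hnorm H (name f) = sqrt (\<integral>x. (cmod (f x))\<^sup>2 \<partial>M)"
  by (simp add: hnorm_def ip_self_eq)

lemma ennreal_hnorm_sq:
  assumes "f \<in> L2 M"
  shows "ennreal ((hnorm H (name f))\<^sup>2) = (\<integral>\<^sup>+x. ennreal ((cmod (f x))\<^sup>2) \<partial>M)"
  using assms by (simp add: hnorm_name nn_integral_eq_integral L2_def)

text \<open>Riesz-Fischer: along a subsequence with rapidly decreasing steps \<open>d k\<close> the
  series of \<open>2 ^ k * \<bar>d k\<bar>\<^sup>2\<close> has a finite integral, so it converges almost everywhere, and
  \<open>\<bar>d k\<bar> \<le> 2 ^ - k + 2 ^ k * \<bar>d k\<bar>\<^sup>2\<close> makes the subsequence converge pointwise. Fatou's lemma then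
  bounds the distance to the pointwise limit.\<close>

lemma mcomplete: "HM.mcomplete"
  unfolding HM.mcomplete_def
proof (intro allI impI)
  fix \<sigma> assume \<sigma>: "HM.MCauchy \<sigma>"
  then have "\<sigma> n \<in> carrier H" for n
    unfolding HM.MCauchy_def by blast
  then have "\<forall>n. \<exists>f. f \<in> L2 M \<and> \<sigma> n = name f"
    by (auto simp: carrier_eq)
  then obtain f where f: "\<And>n. f n \<in> L2 M" "\<And>n. \<sigma> n = name (f n)" by metis
  note [measurable] = L2_measurable[OF f(1)]
  have dist: "ennreal ((hdist H (\<sigma> n) (\<sigma> m))\<^sup>2) = (\<integral>\<^sup>+x. ennreal ((cmod (f n x - f m x))\<^sup>2) \<partial>M)" for n m
    using f by (simp add: hdist_eq name_mem name_diff ennreal_hnorm_sq L2_diff)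
  have "\<exists>N. \<forall>n m. N \<le> n \<longrightarrow> N \<le> m \<longrightarrow> hdist H (\<sigma> n) (\<sigma> m) < (1 / 2) ^ k" for k
    using \<sigma> by (auto simp: HM.MCauchy_def)
  then obtain N where N: "\<And>k n m. N k \<le> n \<Longrightarrow> N k \<le> m \<Longrightarrow> hdist H (\<sigma> n) (\<sigma> m) < (1 / 2) ^ k"
    by metis
  define r where "r k = (\<Sum>i\<le>k. N i)" for k
  have r_ge: "N j \<le> r k" if "j \<le> k" for j k
    unfolding r_def using that by (intro member_le_sum) auto
  define d where "d k x = f (r (Suc k)) x - f (r k) x" for k x
  have [measurable]: "d k \<in> borel_measurable M" for k unfolding d_def by simp
  have step: "(\<integral>\<^sup>+x. ennreal (2 ^ k * (cmod (d k x))\<^sup>2) \<partial>M) \<le> ennreal ((1 / 2) ^ k)" for k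
  proof -
    have "(\<integral>\<^sup>+x. ennreal (2 ^ k * (cmod (d k x))\<^sup>2) \<partial>M) = ennreal (2 ^ k * (hdist H (\<sigma> (r (Suc k))) (\<sigma> (r k)))\<^sup>2)"
      by (simp add: ennreal_mult dist nn_integral_cmult d_def)
    also have "\<dots> \<le> ennreal (2 ^ k * ((1 / 2) ^ k)\<^sup>2)"
      using N[OF r_ge r_ge, of k "Suc k" k] by (intro ennreal_leI mult_left_mono power_mono) auto
    also have "2 ^ k * ((1 / 2) ^ k)\<^sup>2 = (1 / 2 :: real) ^ k"
      by (simp add: power2_eq_square power_one_over field_simps)
    finally show ?thesis .
  qed
  have "(\<integral>\<^sup>+x. (\<Sum>k. ennreal (2 ^ k * (cmod (d k x))\<^sup>2)) \<partial>M) \<le> (\<Sum>k. ennreal ((1 / 2) ^ k))"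
    by (subst nn_integral_suminf, measurable, rule suminf_le[OF step summableI summableI])
  also have "\<dots> < \<infinity>"
    by (subst suminf_ennreal2) (simp_all add: summable_geometric)
  finally have "AE x in M. (\<Sum>k. ennreal (2 ^ k * (cmod (d k x))\<^sup>2)) \<noteq> \<infinity>"
    by (intro nn_integral_noteq_infinite) auto
  then have "AE x in M. convergent (\<lambda>k. f (r k) x)"
  proof (rule AE_mp, intro AE_I2 impI)
    fix x assume "(\<Sum>k. ennreal (2 ^ k * (cmod (d k x))\<^sup>2)) \<noteq> \<infinity>"
    then have sum: "summable (\<lambda>k. (1 / 2) ^ k + 2 ^ k * (cmod (d k x))\<^sup>2)"
      by (intro summable_add summable_suminf_not_top summable_geometric) auto
    have bound: "cmod (d k x) \<le> (1 / 2) ^ k + 2 ^ k * (cmod (d k x))\<^sup>2" for k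
    proof (cases "cmod (d k x) \<le> (1 / 2) ^ k")
      case False
      then have "1 * cmod (d k x) \<le> (2 ^ k * cmod (d k x)) * cmod (d k x)"
        by (intro mult_right_mono) (simp_all add: power_one_over field_simps)
      then show ?thesis by (simp add: power2_eq_square mult.assoc add_increasing)
    qed (simp add: add_increasing2)
    have "summable (\<lambda>k. d k x)"
      by (rule summable_comparison_test'[OF sum, of 0]) (use bound in auto)
    then have "convergent (\<lambda>n. \<Sum>k<n. d k x)"
      by (simp add: summable_iff_convergent)
    moreover have "(\<Sum>k<n. d k x) = f (r n) x - f (r 0) x" for n
      unfolding d_def by (rule sum_lessThan_telescope[of "\<lambda>k. f (r k) x"])
    ultimately have "convergent (\<lambda>n. (f (r n) x - f (r 0) x) + f (r 0) x)"
      by (intro convergent_add) (auto simp: convergent_const)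
    then show "convergent (\<lambda>k. f (r k) x)" by simp
  qed
  then have conv: "AE x in M. (\<lambda>k. f (r k) x) \<longlonglongrightarrow> lim (\<lambda>k. f (r k) x)"
    by (simp add: convergent_LIMSEQ_iff)
  define g where "g x = lim (\<lambda>k. f (r k) x)" for x
  have g [measurable]: "g \<in> borel_measurable M"
    unfolding g_def by (rule borel_measurable_lim_metric) simp
  have close: "(\<integral>\<^sup>+x. ennreal ((cmod (f n x - g x))\<^sup>2) \<partial>M) \<le> ennreal (((1 / 2) ^ j)\<^sup>2)" if "n \<ge> N j" for n j
  proof -
    have "(\<integral>\<^sup>+x. ennreal ((cmod (f n x - g x))\<^sup>2) \<partial>M)
        = (\<integral>\<^sup>+x. liminf (\<lambda>k. ennreal ((cmod (f n x - f (r k) x))\<^sup>2)) \<partial>M)"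
    proof (rule nn_integral_cong_AE, rule AE_mp[OF conv], intro AE_I2 impI)
      fix x assume "(\<lambda>k. f (r k) x) \<longlonglongrightarrow> lim (\<lambda>k. f (r k) x)"
      then have "(\<lambda>k. ennreal ((cmod (f n x - f (r k) x))\<^sup>2)) \<longlonglongrightarrow> ennreal ((cmod (f n x - g x))\<^sup>2)"
        unfolding g_def by (intro tendsto_intros tendsto_ennrealI)
      then show "ennreal ((cmod (f n x - g x))\<^sup>2) = liminf (\<lambda>k. ennreal ((cmod (f n x - f (r k) x))\<^sup>2))"
        by (rule lim_imp_Liminf[symmetric, rotated]) simp
    qed
    also have "\<dots> \<le> liminf (\<lambda>k. \<integral>\<^sup>+x. ennreal ((cmod (f n x - f (r k) x))\<^sup>2) \<partial>M)"
      by (rule nn_integral_liminf) simp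
    also have "\<dots> \<le> ennreal (((1 / 2) ^ j)\<^sup>2)"
    proof -
      have "\<forall>\<^sub>F k in sequentially. (\<integral>\<^sup>+x. ennreal ((cmod (f n x - f (r k) x))\<^sup>2) \<partial>M) \<le> ennreal (((1 / 2) ^ j)\<^sup>2)"
        using eventually_ge_at_top[of j]
      proof eventually_elim
        case (elim k)
        show ?case
          unfolding dist[symmetric] using N[OF that r_ge[OF elim]]
          by (intro ennreal_leI power_mono) auto
      qed
      then have "liminf (\<lambda>k. \<integral>\<^sup>+x. ennreal ((cmod (f n x - f (r k) x))\<^sup>2) \<partial>M) \<le> liminf (\<lambda>k::nat. ennreal (((1 / 2) ^ j)\<^sup>2))"
        by (rule Liminf_mono)
      then show ?thesis by (simp add: Liminf_const)
    qed
    finally show ?thesis .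
  qed
  have diffL: "(\<lambda>x. f n x - g x) \<in> L2 M" if "n \<ge> N 0" for n
    using close[OF that] by (auto simp: L2_iff intro: le_less_trans)
  have gL: "g \<in> L2 M"
    using L2_diff[OF f(1)[of "N 0"] diffL[OF order_refl]] by simp
  have "hdist H (\<sigma> n) (name g) \<le> (1 / 2) ^ j" if "n \<ge> N j" for n j
  proof -
    have "ennreal ((hdist H (\<sigma> n) (name g))\<^sup>2) \<le> ennreal (((1 / 2) ^ j)\<^sup>2)"
      using f gL close[OF that] by (simp add: hdist_eq name_mem name_diff ennreal_hnorm_sq L2_diff)
    then have "(hdist H (\<sigma> n) (name g))\<^sup>2 \<le> ((1 / 2) ^ j)\<^sup>2"
      by (subst (asm) ennreal_le_iff) auto
    then show ?thesis by (rule power2_le_imp_le) simp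
  qed
  moreover have "\<exists>j. (1 / 2) ^ j < e" if "e > 0" for e :: real
    using real_arch_pow_inv[OF that, of "1 / 2"] by simp
  ultimately have "\<exists>N. \<forall>n\<ge>N. hdist H (\<sigma> n) (name g) < e" if "e > 0" for e
    using that by (meson le_less_trans)
  then have "limitin HM.mtopology \<sigma> (name g) sequentially"
    using f gL by (auto simp: HM.limit_metric_sequentially name_mem)
  then show "\<exists>x. limitin HM.mtopology \<sigma> x sequentially" by blast
qed

sublocale complex_hilbert_space H
  by (intro complex_hilbert_space.intro complex_hilbert_space_axioms.intro mcomplete
      complex_inner_product_space_axioms)

end

text \<open>Any choice of names that separates exactly the almost everywhere different functions
  yields a model.\<close>

definition L2_space :: "'x measure \<Rightarrow> (('x \<Rightarrow> complex) \<Rightarrow> 'b) \<Rightarrow> 'b inner_space" where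
  "L2_space M name =
     (let rep = inv_into (L2 M) name in
     \<lparr>carrier = name ` L2 M, monoid.mult = undefined, one = undefined,
      ring.zero = name (\<lambda>x. 0), add = (\<lambda>u v. name (\<lambda>x. rep u x + rep v x)),
      smult = (\<lambda>a u. name (\<lambda>x. a * rep u x)),
      ip = (\<lambda>u v. \<integral>x. rep u x * cnj (rep v x) \<partial>M)\<rparr>)"

lemma L2_model_L2_space:
  assumes name: "\<And>f g. f \<in> L2 M \<Longrightarrow> g \<in> L2 M \<Longrightarrow> name f = name g \<longleftrightarrow> (AE x in M. f x = g x)"
  shows "L2_model M (L2_space M name) name"
proof -
  define rep where "rep = inv_into (L2 M) name"
  have rep: "rep (name f) \<in> L2 M" "AE x in M. rep (name f) x = f x" if "f \<in> L2 M" for f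
  proof -
    show *: "rep (name f) \<in> L2 M" unfolding rep_def using that by (rule inv_into_into[OF imageI])
    have "name (rep (name f)) = name f" unfolding rep_def using that by (rule f_inv_into_f[OF imageI])
    then show "AE x in M. rep (name f) x = f x" using name * that by blast
  qed
  show ?thesis
  proof
    fix f g assume f: "f \<in> L2 M" and g: "g \<in> L2 M"
    note [measurable] = L2_measurable[OF f] L2_measurable[OF g]
      L2_measurable[OF rep(1)[OF f]] L2_measurable[OF rep(1)[OF g]]
    show "name f \<oplus>\<^bsub>L2_space M name\<^esub> name g = name (\<lambda>x. f x + g x)"
      using rep[OF f] rep[OF g] f g
      by (auto simp: L2_space_def Let_def rep_def[symmetric] name L2_add)
    show "ip (L2_space M name) (name f) (name g) = (\<integral>x. f x * cnj (g x) \<partial>M)"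
      using rep(2)[OF f] rep(2)[OF g]
      by (auto simp: L2_space_def Let_def rep_def[symmetric] intro!: integral_cong_AE)
  next
    fix f a assume f: "f \<in> L2 M"
    show "a \<odot>\<^bsub>L2_space M name\<^esub> name f = name (\<lambda>x. a * f x)"
      using rep[OF f] f by (auto simp: L2_space_def Let_def rep_def[symmetric] name L2_smult)
  qed (auto simp: L2_space_def Let_def name)
qed

context L2_model
begin

definition mult_operator :: "('x \<Rightarrow> real) \<Rightarrow> 'b rel" where
  "mult_operator \<phi> = {(name f, name g) | f g.
     f \<in> L2 M \<and> g \<in> L2 M \<and> (AE x in M. g x = complex_of_real (\<phi> x) * f x)}"

lemma mult_operatorI:
  "\<lbrakk>f \<in> L2 M; g \<in> L2 M; AE x in M. g x = complex_of_real (\<phi> x) * f x\<rbrakk>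
    \<Longrightarrow> (name f, name g) \<in> mult_operator \<phi>"
  unfolding mult_operator_def by blast

lemma linear_mult_operator: "linear_operator H (mult_operator \<phi>)"
  unfolding linear_operator_def
proof (intro conjI allI impI)
  show "mult_operator \<phi> \<subseteq> carrier H \<times> carrier H"
    by (auto simp: mult_operator_def name_mem)
  show "single_valued (mult_operator \<phi>)"
  proof (rule single_valuedI)
    fix u v w assume "(u, v) \<in> mult_operator \<phi>" "(u, w) \<in> mult_operator \<phi>"
    then obtain f g f' g' where f: "f \<in> L2 M" "g \<in> L2 M" "AE x in M. g x = complex_of_real (\<phi> x) * f x"
      and f': "f' \<in> L2 M" "g' \<in> L2 M" "AE x in M. g' x = complex_of_real (\<phi> x) * f' x"
      and eq: "u = name f" "v = name g" "u = name f'" "w = name g'"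
      by (auto simp: mult_operator_def)
    have "AE x in M. f x = f' x"
      using eq name_eq_iff[OF f(1) f'(1)] by simp
    then have "AE x in M. g x = g' x"
      using f(3) f'(3) by auto
    then show "v = w"
      using eq name_eq_iff[OF f(2) f'(2)] by simp
  qed
  show "(\<zero>, \<zero>) \<in> mult_operator \<phi>"
    unfolding zero_eq by (rule mult_operatorI) (simp_all add: L2_zero)
next
  fix u u' v v' assume "(u, u') \<in> mult_operator \<phi>" "(v, v') \<in> mult_operator \<phi>"
  then obtain f g f' g' where f: "f \<in> L2 M" "g \<in> L2 M" "AE x in M. g x = complex_of_real (\<phi> x) * f x"
    and f': "f' \<in> L2 M" "g' \<in> L2 M" "AE x in M. g' x = complex_of_real (\<phi> x) * f' x"
    and eq: "u = name f" "u' = name g" "v = name f'" "v' = name g'"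
    by (auto simp: mult_operator_def)
  have "AE x in M. g x + g' x = complex_of_real (\<phi> x) * (f x + f' x)"
    using f(3) f'(3) by eventually_elim (simp add: algebra_simps)
  then show "(u \<oplus> v, u' \<oplus> v') \<in> mult_operator \<phi>"
    using f f' by (simp add: eq add_eq mult_operatorI L2_add)
next
  fix c u u' assume "(u, u') \<in> mult_operator \<phi>"
  then obtain f g where f: "f \<in> L2 M" "g \<in> L2 M" "AE x in M. g x = complex_of_real (\<phi> x) * f x"
    and eq: "u = name f" "u' = name g"
    by (auto simp: mult_operator_def)
  have "AE x in M. c * g x = complex_of_real (\<phi> x) * (c * f x)"
    using f(3) by eventually_elim (simp add: algebra_simps)
  then show "(c \<odot> u, c \<odot> u') \<in> mult_operator \<phi>"
    using f by (simp add: eq smult_eq mult_operatorI L2_smult)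
qed

text \<open>Multiplication by a real function on its maximal domain is self-adjoint: testing a member
  of the adjoint against the functions cut off to \<open>\<bar>\<phi>\<bar> \<le> n\<close> shows that it acts as
  multiplication by \<open>\<phi>\<close>.\<close>

lemma adjoint_mult_operator:
  assumes [measurable]: "\<phi> \<in> borel_measurable M"
  shows "adjoint_operator H (mult_operator \<phi>) = mult_operator \<phi>"
proof
  show "mult_operator \<phi> \<subseteq> adjoint_operator H (mult_operator \<phi>)"
  proof clarify
    fix u v assume "(u, v) \<in> mult_operator \<phi>"
    then obtain f g where f: "f \<in> L2 M" "g \<in> L2 M" "AE x in M. g x = complex_of_real (\<phi> x) * f x"
      and eq: "u = name f" "v = name g"
      by (auto simp: mult_operator_def)
    have "ip H (name g') u = ip H (name f') v"
      if f': "f' \<in> L2 M" "g' \<in> L2 M" "AE x in M. g' x = complex_of_real (\<phi> x) * f' x" for f' g'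
    proof -
      have "AE x in M. g' x * cnj (f x) = f' x * cnj (g x)"
        using f(3) f'(3) by eventually_elim simp
      moreover have [measurable]: "f \<in> borel_measurable M" "g \<in> borel_measurable M"
          "f' \<in> borel_measurable M" "g' \<in> borel_measurable M"
        using f f' by (auto simp: L2_def)
      ultimately show ?thesis
        using f f' by (simp add: eq ip_eq) (intro integral_cong_AE, auto)
    qed
    then show "(u, v) \<in> adjoint_operator H (mult_operator \<phi>)"
      using f eq by (auto simp: adjoint_operator_def mult_operator_def name_mem)
  qed
  show "adjoint_operator H (mult_operator \<phi>) \<subseteq> mult_operator \<phi>"
  proof clarify
    fix u v assume uv: "(u, v) \<in> adjoint_operator H (mult_operator \<phi>)"
    then obtain g h where g: "g \<in> L2 M" "u = name g" and h: "h \<in> L2 M" "v = name h"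
      by (auto simp: adjoint_operator_def carrier_eq)
    note [measurable] = L2_measurable[OF g(1)] L2_measurable[OF h(1)]
    define \<kappa> where "\<kappa> n x = (if \<bar>\<phi> x\<bar> \<le> real n then 1 else 0 :: complex)" for n :: nat and x
    define k where "k n x = \<kappa> n x * (complex_of_real (\<phi> x) * g x - h x)" for n x
    have [measurable]: "\<kappa> n \<in> borel_measurable M" for n
      unfolding \<kappa>_def by measurable
    have [measurable]: "k n \<in> borel_measurable M" for n
      unfolding k_def by measurable
    have kn: "k n \<in> L2 M" for n
    proof -
      have "(\<lambda>x. \<kappa> n x * complex_of_real (\<phi> x) * g x) \<in> L2 M"
        by (rule L2_bound[OF L2_smult[OF g(1), of "of_nat n"]])
          (auto simp: \<kappa>_def norm_mult intro!: mult_right_mono)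
      moreover have "(\<lambda>x. \<kappa> n x * h x) \<in> L2 M"
        by (rule L2_bound[OF h(1)]) (auto simp: \<kappa>_def)
      ultimately have "(\<lambda>x. \<kappa> n x * complex_of_real (\<phi> x) * g x - \<kappa> n x * h x) \<in> L2 M"
        by (rule L2_diff)
      then show ?thesis
        by (simp add: k_def[abs_def] algebra_simps)
    qed
    have \<phi>kn: "(\<lambda>x. complex_of_real (\<phi> x) * k n x) \<in> L2 M" for n
      by (rule L2_bound[OF L2_smult[OF kn[of n], of "of_nat n"]])
        (auto simp: k_def \<kappa>_def norm_mult intro!: mult_right_mono)
    have "AE x in M. k n x = 0" for n
    proof (rule ip_self_eq_0_imp_AE[OF kn])
      have "(name (k n), name (\<lambda>x. complex_of_real (\<phi> x) * k n x)) \<in> mult_operator \<phi>"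
        using kn \<phi>kn unfolding mult_operator_def by blast
      then have "ip H (name (\<lambda>x. complex_of_real (\<phi> x) * k n x)) (name g) = ip H (name (k n)) (name h)"
        using uv unfolding adjoint_operator_def g(2) h(2) by blast
      then have "(\<integral>x. complex_of_real (\<phi> x) * k n x * cnj (g x) \<partial>M) - (\<integral>x. k n x * cnj (h x) \<partial>M) = 0"
        using kn \<phi>kn g h by (simp add: ip_eq)
      then have "(\<integral>x. complex_of_real (\<phi> x) * k n x * cnj (g x) - k n x * cnj (h x) \<partial>M) = 0"
        using L2_mult_integrable[OF \<phi>kn g(1)] L2_mult_integrable[OF kn h(1)]
        by (subst Bochner_Integration.integral_diff) auto
      also have "(\<lambda>x. complex_of_real (\<phi> x) * k n x * cnj (g x) - k n x * cnj (h x)) = (\<lambda>x. k n x * cnj (k n x))"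
        by (auto simp: k_def \<kappa>_def algebra_simps)
      finally show "ip H (name (k n)) (name (k n)) = 0"
        using kn by (simp add: ip_eq)
    qed
    then have "AE x in M. \<forall>n. k n x = 0"
      by (simp add: AE_all_countable)
    then have "AE x in M. h x = complex_of_real (\<phi> x) * g x"
    proof eventually_elim
      case (elim x)
      obtain n where "\<bar>\<phi> x\<bar> \<le> real n" using real_arch_simple by blast
      then show ?case using elim[rule_format, of n] by (simp add: k_def \<kappa>_def)
    qed
    then show "(u, v) \<in> mult_operator \<phi>"
      using g h unfolding mult_operator_def by blast
  qed
qed

end

section \<open>Unordered sums and the space \<open>\<ell>\<^sup>2(V)\<close>\<close>

text \<open>The index set may be uncountable. If the sum is finite, only finitely many terms exceed
  \<open>1 / (n + 1)\<close>, and monotone convergence applies to the sums over these terms.\<close>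

lemma infsum_eq_nn_integral_count_space:
  fixes f :: "'i \<Rightarrow> ennreal"
  shows "infsum f A = (\<integral>\<^sup>+a. f a \<partial>count_space A)"
proof (rule antisym)
  have sup: "infsum f A = (SUP F\<in>{F. finite F \<and> F \<subseteq> A}. sum f F)"
    by (rule nonneg_infsum_complete) simp
  have fin_le: "sum f F \<le> infsum f A" if "finite F" "F \<subseteq> A" for F
    unfolding sup using that by (intro SUP_upper) auto
  have fin_int: "(\<integral>\<^sup>+a. f a * indicator F a \<partial>count_space A) = sum f F"
    if "finite F" "F \<subseteq> A" for F
  proof -
    have "(\<integral>\<^sup>+a. f a * indicator F a \<partial>count_space A) = (\<Sum>a\<in>F. f a * indicator F a)"
      using that by (intro nn_integral_count_space') auto
    also have "\<dots> = sum f F"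
      by (intro sum.cong) auto
    finally show ?thesis .
  qed
  show "infsum f A \<le> (\<integral>\<^sup>+a. f a \<partial>count_space A)"
    unfolding sup
  proof (rule SUP_least, clarify)
    fix F assume F: "finite F" "F \<subseteq> A"
    have "sum f F = (\<integral>\<^sup>+a. f a * indicator F a \<partial>count_space A)"
      by (rule fin_int[OF F, symmetric])
    also have "\<dots> \<le> (\<integral>\<^sup>+a. f a \<partial>count_space A)"
      by (intro nn_integral_mono) (auto simp: indicator_def)
    finally show "sum f F \<le> (\<integral>\<^sup>+a. f a \<partial>count_space A)" .
  qed
  show "(\<integral>\<^sup>+a. f a \<partial>count_space A) \<le> infsum f A"
  proof (cases "infsum f A = \<infinity>")
    case False
    then obtain S where S: "infsum f A = ennreal S" "S \<ge> 0"
      by (cases "infsum f A") auto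
    define F where "F n = {a \<in> A. ennreal (1 / real (Suc n)) < f a}" for n
    have finF: "finite (F n)" for n
    proof (rule ccontr)
      assume inf: "infinite (F n)"
      have "real m * (1 / real (Suc n)) \<le> S" for m
      proof -
        obtain G where G: "finite G" "card G = m" "G \<subseteq> F n"
          using infinite_arbitrarily_large[OF inf] by blast
        have "ennreal (real m * (1 / real (Suc n))) = (\<Sum>a\<in>G. ennreal (1 / real (Suc n)))"
          using G by (subst sum_ennreal) simp_all
        also have "\<dots> \<le> sum f G"
          using G by (intro sum_mono) (auto simp: F_def intro: less_imp_le)
        also have "\<dots> \<le> ennreal S"
          using G fin_le[of G] S by (auto simp: F_def)
        finally show ?thesis
          using S(2) by (subst (asm) ennreal_le_iff) auto
      qed
      moreover obtain m where "S * real (Suc n) < real m"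
        using reals_Archimedean2 by blast
      ultimately show False
        by (simp add: divide_le_eq not_le[symmetric])
    qed
    have "(\<integral>\<^sup>+a. f a \<partial>count_space A) = (\<integral>\<^sup>+a. (SUP n. f a * indicator (F n) a) \<partial>count_space A)"
    proof (rule nn_integral_cong)
      fix a assume a: "a \<in> space (count_space A)"
      show "f a = (SUP n. f a * indicator (F n) a)"
      proof (cases "f a = 0")
        case False
        then obtain n where "ennreal (1 / real (Suc n)) < f a"
        proof (cases "f a")
          case (real r)
          then have "r > 0" using False by (cases "r = 0") auto
          then obtain n where "inverse (real (Suc n)) < r"
            using reals_Archimedean by blast
          then have "ennreal (1 / real (Suc n)) < f a"
            using real by (simp add: inverse_eq_divide ennreal_less_iff del: of_nat_Suc)
          then show ?thesis by (rule that)
        next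
          case top
          then show ?thesis using that[of 0] by simp
        qed
        then have "f a = f a * indicator (F n) a" using a by (auto simp: F_def)
        then have "f a \<le> (SUP n. f a * indicator (F n) a)" by (metis SUP_upper UNIV_I)
        moreover have "(SUP n. f a * indicator (F n) a) \<le> f a"
          by (rule SUP_least) (auto simp: indicator_def)
        ultimately show ?thesis by (rule antisym)
      qed simp
    qed
    also have "\<dots> = (SUP n. \<integral>\<^sup>+a. f a * indicator (F n) a \<partial>count_space A)"
    proof (rule nn_integral_monotone_convergence_SUP)
      have "ennreal (1 / real (Suc (Suc n))) \<le> ennreal (1 / real (Suc n))" for n
        by (intro ennreal_leI divide_left_mono) auto
      then have "F n \<subseteq> F (Suc n)" for n
        unfolding F_def using le_less_trans by blast
      then show "incseq (\<lambda>n a. f a * indicator (F n) a)"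
        by (intro incseq_SucI le_funI mult_left_mono) (auto simp: indicator_def)
    qed simp
    also have "\<dots> \<le> infsum f A"
    proof (rule SUP_least)
      fix n
      have sub: "F n \<subseteq> A" by (auto simp: F_def)
      show "(\<integral>\<^sup>+a. f a * indicator (F n) a \<partial>count_space A) \<le> infsum f A"
        unfolding fin_int[OF finF sub] by (rule fin_le[OF finF sub])
    qed
    finally show ?thesis .
  qed simp
qed

lemma L2_count_space_iff:
  "f \<in> L2 (count_space V) \<longleftrightarrow> (\<lambda>v. (cmod (f v))\<^sup>2) summable_on V"
  by (subst summable_on_iff_abs_summable_on_real, subst abs_summable_equivalent)
    (simp add: L2_def abs_summable_on_def)

definition extend_zero :: "'v set \<Rightarrow> ('v \<Rightarrow> complex) \<Rightarrow> 'v \<Rightarrow> complex" where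
  "extend_zero V f v = (if v \<in> V then f v else 0)"

lemma carrier_ell2: "f \<in> carrier (ell2 V) \<longleftrightarrow> (\<forall>v. v \<notin> V \<longrightarrow> f v = 0) \<and> f \<in> L2 (count_space V)"
  by (simp add: ell2_def L2_count_space_iff)

lemma L2_model_ell2: "L2_model (count_space V) (ell2 V) (extend_zero V)"
proof
  have ext: "extend_zero V f \<in> L2 (count_space V)" if "f \<in> L2 (count_space V)" for f
    by (rule L2_bound[OF that]) (auto simp: extend_zero_def)
  show "carrier (ell2 V) = extend_zero V ` L2 (count_space V)"
  proof (intro Set.set_eqI iffI)
    fix f assume "f \<in> carrier (ell2 V)"
    then have "f = extend_zero V f" "f \<in> L2 (count_space V)"
      by (auto simp: carrier_ell2 extend_zero_def)
    then show "f \<in> extend_zero V ` L2 (count_space V)" by blast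
  qed (use ext in \<open>auto simp: carrier_ell2 extend_zero_def\<close>)
next
  fix f g assume fg: "f \<in> L2 (count_space V)" "g \<in> L2 (count_space V)"
  show "extend_zero V f = extend_zero V g" if "AE v in count_space V. f v = g v"
    using that by (auto simp: AE_count_space extend_zero_def)
  have "infsetsum (\<lambda>v. f v * cnj (g v)) V = infsum (\<lambda>v. f v * cnj (g v)) V"
    using L2_mult_integrable[OF fg]
    by (intro infsetsum_infsum) (simp add: abs_summable_equivalent abs_summable_on_def)
  moreover have "ip (ell2 V) (extend_zero V f) (extend_zero V g) = infsum (\<lambda>v. f v * cnj (g v)) V"
    by (auto simp: ell2_def extend_zero_def intro!: infsum_cong)
  ultimately show "ip (ell2 V) (extend_zero V f) (extend_zero V g)
      = (\<integral>v. f v * cnj (g v) \<partial>count_space V)"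
    by (simp add: infsetsum_def)
qed (auto simp: ell2_def extend_zero_def fun_eq_iff)

section \<open>Integrals over rational half lines determine a function\<close>

lemma AE_eq_0_if_half_line_integrals_0:
  fixes h :: "real \<Rightarrow> complex"
  assumes N: "finite_measure N" "sets N = sets borel" and h: "integrable N h"
    and rat: "\<And>q :: rat. (LINT s:{..real_of_rat q}|N. h s) = 0"
  shows "AE s in N. h s = 0"
proof -
  interpret finite_measure N by fact
  note N(2)[measurable_cong]
  have si: "set_integrable N A h" if "A \<in> sets borel" for A
    using h that N(2) by (simp add: set_integrable_def integrable_mult_indicator)
  \<comment> \<open>Half lines with real end points are limits of those with rational end points.\<close>
  have half: "(LINT s:{..a}|N. h s) = 0" for a :: real
  proof -
    have "\<exists>q. a < real_of_rat q \<and> real_of_rat q < a + 1 / real (Suc n)" for n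
      by (rule of_rat_dense) simp
    then obtain q where q: "\<And>n. a < real_of_rat (q n)" "\<And>n. real_of_rat (q n) < a + 1 / real (Suc n)"
      by metis
    have "(\<lambda>n. real_of_rat (q n)) \<longlonglongrightarrow> a"
    proof (rule tendsto_sandwich[of "\<lambda>n. a" _ _ "\<lambda>n. a + 1 / real (Suc n)"])
      have "(\<lambda>n. a + 1 / real (Suc n)) \<longlonglongrightarrow> a + 0"
        by (intro tendsto_intros LIMSEQ_Suc[OF lim_1_over_n])
      then show "(\<lambda>n. a + 1 / real (Suc n)) \<longlonglongrightarrow> a" by simp
    qed (use q in \<open>auto intro!: always_eventually less_imp_le\<close>)
    have ptw: "(\<lambda>n. indicator {..real_of_rat (q n)} s *\<^sub>R h s) \<longlonglongrightarrow> indicator {..a} s *\<^sub>R h s" for s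
    proof (cases "s \<le> a")
      case True
      then show ?thesis using q(1) by (auto simp: indicator_def less_imp_le order_trans)
    next
      case False
      then have "\<forall>\<^sub>F n in sequentially. real_of_rat (q n) < s"
        using order_tendstoD(2)[OF \<open>(\<lambda>n. real_of_rat (q n)) \<longlonglongrightarrow> a\<close>] by simp
      then have "\<forall>\<^sub>F n in sequentially. indicator {..real_of_rat (q n)} s *\<^sub>R h s = indicator {..a} s *\<^sub>R h s"
        by eventually_elim (use False in \<open>auto simp: indicator_def\<close>)
      then show ?thesis by (rule tendsto_eventually)
    qed
    have "(\<lambda>n. LINT s:{..real_of_rat (q n)}|N. h s) \<longlonglongrightarrow> (LINT s:{..a}|N. h s)"
      unfolding set_lebesgue_integral_def
      by (rule integral_dominated_convergence[where w = "\<lambda>s. norm (h s)"])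
        (use h ptw in \<open>auto simp: indicator_def\<close>)
    then show ?thesis
      by (simp add: rat LIMSEQ_const_iff)
  qed
  have total: "(LINT s:UNIV|N. h s) = 0"
  proof -
    have "incseq (\<lambda>n. {..real n})" by (auto simp: incseq_def)
    moreover have "(\<Union>n. {..real n}) = UNIV" using real_arch_simple by blast
    ultimately have "(\<lambda>n. LINT s:{..real n}|N. h s) \<longlonglongrightarrow> (LINT s:UNIV|N. h s)"
      using set_integral_cont_up[of "\<lambda>n. {..real n}" N h] si[of UNIV] N(2) by simp
    then show ?thesis by (simp add: half LIMSEQ_const_iff)
  qed
  have "(LINT s:A|N. h s) = 0" if "A \<in> sets borel" for A
  proof -
    have A: "A \<in> sigma_sets UNIV (range atMost)"
      using that unfolding borel_eq_atMost by simp
    have Int: "Int_stable (range (atMost :: real \<Rightarrow> real set))"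
      by (auto simp: Int_stable_def Int_atMost)
    have borel: "B \<in> sets borel" if "B \<in> sigma_sets UNIV (range atMost)" for B :: "real set"
      using that unfolding borel_eq_atMost by simp
    show ?thesis
    proof (rule sigma_sets_induct_disjoint[OF Int _ A])
      fix B assume B: "B \<in> sigma_sets UNIV (range atMost)" "(LINT s:B|N. h s) = 0"
      have "(LINT s:B \<union> (UNIV - B)|N. h s) = (LINT s:B|N. h s) + (LINT s:UNIV - B|N. h s)"
        using borel[OF B(1)] by (intro set_integral_Un si) auto
      then show "(LINT s:UNIV - B|N. h s) = 0" using total B(2) by simp
    next
      fix B :: "nat \<Rightarrow> real set"
      assume B: "disjoint_family B" "range B \<subseteq> sigma_sets UNIV (range atMost)"
        "\<And>i. (LINT s:B i|N. h s) = 0"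
      have bor: "B i \<in> sets borel" for i using B(2) borel by blast
      have "(LINT s:(\<Union>i. B i)|N. h s) = (\<Sum>i. LINT s:B i|N. h s)"
        using B(1) bor N(2) by (intro lebesgue_integral_countable_add si) (auto simp: disjoint_family_on_def)
      then show "(LINT s:(\<Union>i. B i)|N. h s) = 0" by (simp add: B(3))
    qed (auto simp: half, simp add: set_lebesgue_integral_def)
  qed
  then show ?thesis
    using h N(2) by (intro density_zero) auto
qed

section \<open>Consistent systems of measures on a directed tree\<close>

text \<open>The measures live on the whole line, with all mass on \<open>s \<ge> 0\<close>, so that measurability refers to
  the Borel sets throughout; consistency is stated for integrals, the form in which it is used.\<close>

locale consistent_measures = directed_tree V E
  for V :: "'v set" and E :: "'v rel" +
  fixes lam :: "'v \<Rightarrow> complex" and \<kappa> :: "'v \<Rightarrow> real measure" and \<epsilon> :: "'v \<Rightarrow> real"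
  assumes prob: "v \<in> V \<Longrightarrow> prob_space (\<kappa> v)"
    and sets_\<kappa>: "v \<in> V \<Longrightarrow> sets (\<kappa> v) = sets borel"
    and nonneg_\<kappa>: "v \<in> V \<Longrightarrow> AE s in \<kappa> v. 0 \<le> s"
    and consistent: "\<lbrakk>u \<in> V; g \<in> borel_measurable borel\<rbrakk> \<Longrightarrow>
      (\<integral>\<^sup>+s. g s \<partial>\<kappa> u) =
        (\<integral>\<^sup>+v. ennreal ((cmod (lam v))\<^sup>2) * (\<integral>\<^sup>+s. g s * (1 / ennreal s) \<partial>\<kappa> v) \<partial>count_space (Chi E u))
        + ennreal (\<epsilon> u) * g 0"
begin

lemma edge_vertices: "(u, v) \<in> E \<Longrightarrow> u \<in> V \<and> v \<in> V"
  using edges by auto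

lemma edge_iff_par: "(u, v) \<in> E \<longleftrightarrow> v \<in> nonroots V E \<and> u = par E v"
proof
  assume e: "(u, v) \<in> E"
  then have v: "v \<in> nonroots V E" using edge_vertices by (auto simp: nonroots_def)
  moreover have "par E v = u"
    unfolding par_def using parent_unique[OF v] e by (intro the_equality) auto
  ultimately show "v \<in> nonroots V E \<and> u = par E v" by simp
next
  assume "v \<in> nonroots V E \<and> u = par E v"
  then show "(u, v) \<in> E"
    unfolding par_def using theI'[OF parent_unique] by simp
qed

lemma nonroots_subset: "nonroots V E \<subseteq> V"
  by (auto simp: nonroots_def)

lemma sum_over_children:
  fixes T :: "'v \<Rightarrow> 'v \<Rightarrow> ennreal"
  shows "(\<integral>\<^sup>+u. (\<integral>\<^sup>+v. T u v \<partial>count_space (Chi E u)) \<partial>count_space V)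
    = (\<integral>\<^sup>+v. T (par E v) v \<partial>count_space (nonroots V E))"
proof -
  have "(\<integral>\<^sup>+u. (\<integral>\<^sup>+v. T u v \<partial>count_space (Chi E u)) \<partial>count_space V)
      = (\<integral>\<^sup>+u. (\<integral>\<^sup>+v. T u v \<partial>count_space (Chi E u)) \<partial>count_space UNIV)"
  proof (rule nn_integral_count_space_eq)
    fix u assume "u \<in> UNIV - V"
    then have "Chi E u = {}" by (auto simp: Chi_def dest: edge_vertices)
    then show "(\<integral>\<^sup>+v. T u v \<partial>count_space (Chi E u)) = 0"
      by (simp add: nn_integral_count_space_finite)
  qed simp
  also have "\<dots> = (\<integral>\<^sup>+u. (\<integral>\<^sup>+v. (\<lambda>(u, v). T u v * indicator E (u, v)) (u, v) \<partial>count_space UNIV) \<partial>count_space UNIV)"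
    by (rule nn_integral_cong, subst nn_integral_count_space_indicator, simp, rule nn_integral_cong)
      (simp add: Chi_def indicator_def)
  also have "\<dots> = (\<integral>\<^sup>+v. (\<integral>\<^sup>+u. (\<lambda>(u, v). T u v * indicator E (u, v)) (u, v) \<partial>count_space UNIV) \<partial>count_space UNIV)"
    unfolding nn_integral_fst_count_space nn_integral_snd_count_space ..
  also have "\<dots> = (\<integral>\<^sup>+v. T (par E v) v * indicator (nonroots V E) v \<partial>count_space UNIV)"
  proof (rule nn_integral_cong)
    fix v
    have "(\<integral>\<^sup>+u. T u v * indicator E (u, v) \<partial>count_space UNIV)
        = (\<Sum>u\<in>{par E v}. T u v * indicator E (u, v))"
      by (rule nn_integral_count_space') (auto simp: edge_iff_par)
    also have "\<dots> = T (par E v) v * indicator (nonroots V E) v"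
      by (auto simp: indicator_def edge_iff_par)
    finally show "(\<integral>\<^sup>+u. (\<lambda>(u, v). T u v * indicator E (u, v)) (u, v) \<partial>count_space UNIV)
        = T (par E v) v * indicator (nonroots V E) v" by simp
  qed
  also have "\<dots> = (\<integral>\<^sup>+v. T (par E v) v \<partial>count_space (nonroots V E))"
    by (subst nn_integral_count_space_indicator) simp_all
  finally show ?thesis .
qed

definition base :: "('v \<times> real) measure" where
  "base = count_space UNIV \<Otimes>\<^sub>M borel"

text \<open>The disjoint union of the measures \<open>\<kappa> v\<close>, whose square integrable functions form the direct
  sum of the spaces \<open>L\<^sup>2(\<kappa> v)\<close>.\<close>

definition \<nu> :: "('v \<times> real) measure" where
  "\<nu> = count_space V \<bind> (\<lambda>v. distr (\<kappa> v) base (Pair v))"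

lemma measurable_Pair_base [measurable]: "v \<in> V \<Longrightarrow> Pair v \<in> measurable (\<kappa> v) base"
  unfolding base_def by (subst measurable_cong_sets[OF sets_\<kappa> refl]) (auto simp: measurable_Pair)

lemma kernel_measurable: "(\<lambda>v. distr (\<kappa> v) base (Pair v)) \<in> measurable (count_space V) (subprob_algebra base)"
proof (subst measurable_count_space_eq1, intro Pi_I)
  fix v assume v: "v \<in> V"
  interpret prob_space "\<kappa> v" by (rule prob[OF v])
  interpret P: prob_space "distr (\<kappa> v) base (Pair v)" by (rule prob_space_distr) (simp add: v)
  show "distr (\<kappa> v) base (Pair v) \<in> space (subprob_algebra base)"
    using P.subprob_space_axioms by (simp add: space_subprob_algebra)
qed

lemma sets_\<nu> [measurable_cong]: "sets \<nu> = sets base"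
  unfolding \<nu>_def by (rule sets_bind) (use nonempty in auto)

lemma fiber_measurable:
  "f \<in> borel_measurable base \<Longrightarrow> (\<lambda>s. f (v, s)) \<in> borel_measurable borel"
  unfolding base_def by (rule measurable_compose[of "Pair v" borel]) (auto simp: measurable_Pair)

lemma nn_integral_\<nu>:
  assumes "f \<in> borel_measurable base"
  shows "(\<integral>\<^sup>+x. f x \<partial>\<nu>) = (\<integral>\<^sup>+v. (\<integral>\<^sup>+s. f (v, s) \<partial>\<kappa> v) \<partial>count_space V)"
  unfolding \<nu>_def using assms
  by (subst nn_integral_bind[OF _ kernel_measurable])
    (auto intro!: nn_integral_cong simp: nn_integral_distr)

lemma AE_\<nu>:
  assumes "Measurable.pred base P"
  shows "(AE x in \<nu>. P x) \<longleftrightarrow> (\<forall>v\<in>V. AE s in \<kappa> v. P (v, s))"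
  unfolding \<nu>_def using assms
  by (subst AE_bind[OF kernel_measurable])
    (auto simp: AE_count_space AE_distr_iff pred_def)

lemma measurable_vertex: "(\<And>v. h v \<in> space M) \<Longrightarrow> (\<lambda>x. h (fst x)) \<in> measurable base M"
  unfolding base_def by (rule measurable_compose[OF measurable_fst]) simp

lemma measurable_snd_base [measurable]: "snd \<in> borel_measurable base"
  unfolding base_def by (rule measurable_snd)

text \<open>On functions of \<open>(v, s)\<close> supported in \<open>s > 0\<close> this is the polar part of the weighted shift acting
  in the first variable; where \<open>s = 0\<close>, which the shift annihilates, the identity makes it
  isometric.\<close>

definition push :: "('v \<times> real \<Rightarrow> complex) \<Rightarrow> 'v \<times> real \<Rightarrow> complex" where
  "push f = (\<lambda>(v, s). if s > 0
     then (if v \<in> nonroots V E then lam v * f (par E v, s) / complex_of_real (sqrt s) else 0)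
     else f (v, s))"

lemma measurable_push [measurable]:
  assumes f [measurable]: "f \<in> borel_measurable base"
  shows "push f \<in> borel_measurable base"
proof -
  have p [measurable]: "(\<lambda>x. (par E (fst x), snd x)) \<in> measurable base base"
    unfolding base_def
    by (intro measurable_Pair measurable_compose[OF measurable_fst, of "par E"] measurable_snd) simp
  have [measurable]: "(\<lambda>x. lam (fst x)) \<in> borel_measurable base"
    "Measurable.pred base (\<lambda>x. fst x \<in> nonroots V E)"
    by (rule measurable_vertex, simp)+
  have "push f = (\<lambda>x. if snd x > 0
     then (if fst x \<in> nonroots V E then lam (fst x) * f (par E (fst x), snd x) / complex_of_real (sqrt (snd x)) else 0)
     else f x)"
    by (auto simp: push_def)
  also have "\<dots> \<in> borel_measurable base"
    by measurable
  finally show ?thesis .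
qed

text \<open>At \<open>u\<close>, the integral over \<open>s > 0\<close> is by consistency a sum over the children of \<open>u\<close>; summing
  over all \<open>u\<close> counts every non-root once.\<close>

lemma nn_integral_push:
  assumes f [measurable]: "f \<in> borel_measurable base"
  shows "(\<integral>\<^sup>+x. ennreal ((cmod (push f x))\<^sup>2) \<partial>\<nu>) = (\<integral>\<^sup>+x. ennreal ((cmod (f x))\<^sup>2) \<partial>\<nu>)"
proof -
  \<comment> \<open>\<open>G\<close> and \<open>Z\<close> are the contributions of \<open>s > 0\<close> and of \<open>s \<le> 0\<close>, and \<open>T u v\<close> is what the child
    \<open>v\<close> receives from \<open>u\<close>.\<close>
  define G where "G u s = ennreal ((cmod (f (u, s)))\<^sup>2) * indicator {0<..} s" for u s
  define Z where "Z u = (\<integral>\<^sup>+s. ennreal ((cmod (f (u, s)))\<^sup>2) * indicator {..0} s \<partial>\<kappa> u)" for u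
  define T where "T u v = ennreal ((cmod (lam v))\<^sup>2) * (\<integral>\<^sup>+s. G u s * (1 / ennreal s) \<partial>\<kappa> v)" for u v
  note fm [measurable] = fiber_measurable[OF f]
  have [measurable]: "G u \<in> borel_measurable borel" for u
    unfolding G_def by measurable
  have G0: "G u 0 = 0" for u
    by (simp add: G_def)
  have fiber: "(\<integral>\<^sup>+s. ennreal ((cmod (push f (v, s)))\<^sup>2) \<partial>\<kappa> v)
      = T (par E v) v * indicator (nonroots V E) v + Z v" if v: "v \<in> V" for v
  proof -
    note sets_\<kappa>[OF v, measurable_cong]
    have "(\<integral>\<^sup>+s. ennreal ((cmod (push f (v, s)))\<^sup>2) \<partial>\<kappa> v)
      = (\<integral>\<^sup>+s. ennreal ((cmod (lam v))\<^sup>2) * indicator (nonroots V E) v * (G (par E v) s * (1 / ennreal s))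
          + ennreal ((cmod (f (v, s)))\<^sup>2) * indicator {..0} s \<partial>\<kappa> v)"
    proof (rule nn_integral_cong)
      fix s
      have "ennreal ((cmod (lam v * f (par E v, s) / complex_of_real (sqrt s)))\<^sup>2)
        = ennreal ((cmod (lam v))\<^sup>2) * (ennreal ((cmod (f (par E v, s)))\<^sup>2) * (1 / ennreal s))" if "s > 0"
      proof -
        have "1 / ennreal s = ennreal (1 / s)"
          using that divide_ennreal[of 1 s] by simp
        moreover have "(cmod (lam v * f (par E v, s) / complex_of_real (sqrt s)))\<^sup>2
            = (cmod (lam v))\<^sup>2 * ((cmod (f (par E v, s)))\<^sup>2 * (1 / s))"
          using that by (simp add: norm_divide norm_mult power_divide power_mult_distrib)
        ultimately show ?thesis
          using that by (simp add: ennreal_mult'[symmetric] ennreal_mult''[symmetric])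
      qed
      then show "ennreal ((cmod (push f (v, s)))\<^sup>2)
        = ennreal ((cmod (lam v))\<^sup>2) * indicator (nonroots V E) v * (G (par E v) s * (1 / ennreal s))
          + ennreal ((cmod (f (v, s)))\<^sup>2) * indicator {..0} s"
        by (cases "s > 0"; cases "v \<in> nonroots V E") (simp_all add: push_def G_def)
    qed
    also have "\<dots> = ennreal ((cmod (lam v))\<^sup>2) * indicator (nonroots V E) v * (\<integral>\<^sup>+s. G (par E v) s * (1 / ennreal s) \<partial>\<kappa> v) + Z v"
      unfolding Z_def by (subst nn_integral_add, measurable, subst nn_integral_cmult, measurable)
    finally show ?thesis by (simp add: T_def mult_ac)
  qed
  have split: "(\<integral>\<^sup>+s. ennreal ((cmod (f (u, s)))\<^sup>2) \<partial>\<kappa> u)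
      = (\<integral>\<^sup>+v. T u v \<partial>count_space (Chi E u)) + Z u" if u: "u \<in> V" for u
  proof -
    note sets_\<kappa>[OF u, measurable_cong]
    have "(\<integral>\<^sup>+s. ennreal ((cmod (f (u, s)))\<^sup>2) \<partial>\<kappa> u)
        = (\<integral>\<^sup>+s. G u s + ennreal ((cmod (f (u, s)))\<^sup>2) * indicator {..0} s \<partial>\<kappa> u)"
      by (intro nn_integral_cong) (auto simp: G_def indicator_def)
    also have "\<dots> = (\<integral>\<^sup>+s. G u s \<partial>\<kappa> u) + Z u"
      unfolding Z_def by (intro nn_integral_add) measurable
    also have "(\<integral>\<^sup>+s. G u s \<partial>\<kappa> u) = (\<integral>\<^sup>+v. T u v \<partial>count_space (Chi E u))"
      by (subst consistent[OF u]) (simp_all add: T_def[abs_def] G0)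
    finally show ?thesis .
  qed
  have "(\<integral>\<^sup>+x. ennreal ((cmod (push f x))\<^sup>2) \<partial>\<nu>)
      = (\<integral>\<^sup>+v. T (par E v) v * indicator (nonroots V E) v + Z v \<partial>count_space V)"
    by (subst nn_integral_\<nu>) (auto intro!: nn_integral_cong simp: fiber)
  also have "\<dots> = (\<integral>\<^sup>+v. T (par E v) v * indicator (nonroots V E) v \<partial>count_space V) + (\<integral>\<^sup>+v. Z v \<partial>count_space V)"
    by (rule nn_integral_add) auto
  also have "(\<integral>\<^sup>+v. T (par E v) v * indicator (nonroots V E) v \<partial>count_space V)
      = (\<integral>\<^sup>+v. T (par E v) v * indicator (nonroots V E) v \<partial>count_space (nonroots V E))"
    using nonroots_subset by (intro nn_integral_count_space_eq) auto
  also have "\<dots> = (\<integral>\<^sup>+v. T (par E v) v \<partial>count_space (nonroots V E))"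
    by (rule nn_integral_cong) simp
  also have "\<dots> = (\<integral>\<^sup>+u. (\<integral>\<^sup>+v. T u v \<partial>count_space (Chi E u)) \<partial>count_space V)"
    by (rule sum_over_children[symmetric])
  also have "\<dots> + (\<integral>\<^sup>+v. Z v \<partial>count_space V) = (\<integral>\<^sup>+u. (\<integral>\<^sup>+v. T u v \<partial>count_space (Chi E u)) + Z u \<partial>count_space V)"
    by (rule nn_integral_add[symmetric]) auto
  also have "\<dots> = (\<integral>\<^sup>+x. ennreal ((cmod (f x))\<^sup>2) \<partial>\<nu>)"
    by (subst nn_integral_\<nu>) (auto intro!: nn_integral_cong simp: split)
  finally show ?thesis .
qed

section \<open>The normal extension of the weighted shift\<close>

lemma borel_measurable_\<nu>: "borel_measurable \<nu> = borel_measurable base"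
  by (rule measurable_cong_sets[OF sets_\<nu> refl])

lemma L2_\<nu>D [measurable_dest]: "f \<in> L2 \<nu> \<Longrightarrow> f \<in> borel_measurable base"
  by (simp add: L2_def borel_measurable_\<nu>)

text \<open>Since \<open>1 / s\<close> is infinite at \<open>0\<close>, an atom of \<open>\<kappa> v\<close> at \<open>0\<close> would give the parent of \<open>v\<close>
  infinite mass.\<close>

lemma AE_positive:
  assumes v: "v \<in> nonroots V E" and lam: "lam v \<noteq> 0"
  shows "AE s in \<kappa> v. s \<noteq> 0"
proof (rule ccontr)
  have vV: "v \<in> V" using v nonroots_subset by blast
  note sets_\<kappa>[OF vV, measurable_cong]
  let ?u = "par E v"
  have e: "(?u, v) \<in> E" using v by (simp add: edge_iff_par)
  then have u: "?u \<in> V" using edge_vertices by blast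
  assume "\<not> (AE s in \<kappa> v. s \<noteq> 0)"
  then have pos: "emeasure (\<kappa> v) {0} \<noteq> 0"
    using sets_\<kappa>[OF vV] sets_eq_imp_space_eq[OF sets_\<kappa>[OF vV]]
    by (subst (asm) AE_iff_measurable[of "{0}"]) auto
  have "(\<integral>\<^sup>+s. indicator {0} s * (1 / ennreal s) \<partial>\<kappa> v) = (\<integral>\<^sup>+s. \<infinity> * indicator {0} s \<partial>\<kappa> v)"
    by (intro nn_integral_cong) (auto simp: indicator_def divide_ennreal_def)
  also have "\<dots> = \<infinity> * emeasure (\<kappa> v) {0}"
    using sets_\<kappa>[OF vV] by (subst nn_integral_cmult) auto
  also have "\<dots> = \<infinity>" using pos by (simp add: ennreal_top_mult)
  finally have "\<infinity> = ennreal ((cmod (lam v))\<^sup>2) * (\<integral>\<^sup>+s. indicator {0} s * (1 / ennreal s) \<partial>\<kappa> v)"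
    using lam by (simp add: ennreal_mult_top)
  also have "\<dots> \<le> (\<integral>\<^sup>+w. ennreal ((cmod (lam w))\<^sup>2) * (\<integral>\<^sup>+s. indicator {0} s * (1 / ennreal s) \<partial>\<kappa> w) \<partial>count_space (Chi E ?u))"
    using e by (intro nn_integral_ge_point) (simp add: Chi_def)
  also have "\<dots> \<le> (\<integral>\<^sup>+s. indicator {0} s \<partial>\<kappa> ?u)"
    by (subst consistent[OF u]) simp_all
  also have "\<dots> \<le> 1"
  proof -
    interpret prob_space "\<kappa> ?u" by (rule prob[OF u])
    have "(\<integral>\<^sup>+s. indicator {0} s \<partial>\<kappa> ?u) = emeasure (\<kappa> ?u) {0}"
      using sets_\<kappa>[OF u] by (subst nn_integral_indicator) auto
    then show ?thesis by (simp add: emeasure_le_1)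
  qed
  finally show False by (simp add: top_unique)
qed

lemma L2_fiber_integrable:
  assumes f: "f \<in> L2 \<nu>" and v: "v \<in> V"
  shows "integrable (\<kappa> v) (\<lambda>s. f (v, s))"
proof -
  interpret prob_space "\<kappa> v" by (rule prob[OF v])
  have fb [measurable]: "f \<in> borel_measurable base"
    using f by (rule L2_\<nu>D)
  note sets_\<kappa>[OF v, measurable_cong]
  have fm: "(\<lambda>s. f (v, s)) \<in> borel_measurable (\<kappa> v)"
    using fiber_measurable[OF fb, of v] by simp
  have "(\<integral>\<^sup>+s. ennreal ((cmod (f (v, s)))\<^sup>2) \<partial>\<kappa> v) \<le> (\<integral>\<^sup>+x. ennreal ((cmod (f x))\<^sup>2) \<partial>\<nu>)"
    by (subst nn_integral_\<nu>) (auto intro: nn_integral_ge_point[OF v])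
  then have "(\<lambda>s. f (v, s)) \<in> L2 (\<kappa> v)"
    using f fm by (auto simp: L2_iff intro: le_less_trans)
  moreover have "(\<lambda>s. 1) \<in> L2 (\<kappa> v)"
    by (simp add: L2_def)
  ultimately show ?thesis
    using L2_mult_integrable[of "\<lambda>s. f (v, s)" "\<kappa> v" "\<lambda>s. 1"] by simp
qed

text \<open>Since the vertices may be uncountably many, the code of a function keeps the vertex as an
  argument and records countably many numbers for each.\<close>

definition code :: "('v \<times> real \<Rightarrow> complex) \<Rightarrow> nat \<Rightarrow> 'v \<Rightarrow> complex" where
  "code f n v = (if v \<in> V then (LINT s:{..real_of_rat (from_nat n)}|\<kappa> v. f (v, s)) else 0)"

lemma code_eq_iff:
  assumes f: "f \<in> L2 \<nu>" and g: "g \<in> L2 \<nu>"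
  shows "code f = code g \<longleftrightarrow> (AE x in \<nu>. f x = g x)"
proof -
  have [measurable]: "f \<in> borel_measurable base" "g \<in> borel_measurable base"
    using f g by (simp_all add: L2_\<nu>D)
  have AE: "(AE x in \<nu>. f x = g x) \<longleftrightarrow> (\<forall>v\<in>V. AE s in \<kappa> v. f (v, s) = g (v, s))"
    by (rule AE_\<nu>) measurable
  show ?thesis
  proof
    assume eq: "code f = code g"
    show "AE x in \<nu>. f x = g x"
      unfolding AE
    proof
      fix v assume v: "v \<in> V"
      interpret prob_space "\<kappa> v" by (rule prob[OF v])
      note int = L2_fiber_integrable[OF f v] L2_fiber_integrable[OF g v]
      have "AE s in \<kappa> v. f (v, s) - g (v, s) = 0"
      proof (rule AE_eq_0_if_half_line_integrals_0[OF finite_measure_axioms sets_\<kappa>[OF v]])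
        show "integrable (\<kappa> v) (\<lambda>s. f (v, s) - g (v, s))"
          using int by simp
        fix q :: rat
        have si: "set_integrable (\<kappa> v) {..real_of_rat q} h" if "integrable (\<kappa> v) h" for h :: "real \<Rightarrow> complex"
          using that sets_\<kappa>[OF v] by (simp add: set_integrable_def integrable_mult_indicator)
        have "code f (to_nat q) v = code g (to_nat q) v" using eq by simp
        then show "(LINT s:{..real_of_rat q}|\<kappa> v. f (v, s) - g (v, s)) = 0"
          using v by (simp add: code_def set_integral_diff(2)[OF si[OF int(1)] si[OF int(2)]])
      qed
      then show "AE s in \<kappa> v. f (v, s) = g (v, s)" by simp
    qed
  next
    assume "AE x in \<nu>. f x = g x"
    then have ae: "AE s in \<kappa> v. f (v, s) = g (v, s)" if "v \<in> V" for v
      using AE that by simp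
    have "(LINT s:{..real_of_rat q}|\<kappa> v. f (v, s)) = (LINT s:{..real_of_rat q}|\<kappa> v. g (v, s))"
      if v: "v \<in> V" for q v
      unfolding set_lebesgue_integral_def
    proof (rule integral_cong_AE)
      show "AE s in \<kappa> v. indicat_real {..real_of_rat q} s *\<^sub>R f (v, s) = indicat_real {..real_of_rat q} s *\<^sub>R g (v, s)"
        using ae[OF v] by eventually_elim simp
    qed (use L2_fiber_integrable[OF f v] L2_fiber_integrable[OF g v] sets_\<kappa>[OF v] in
        \<open>auto intro!: borel_measurable_integrable integrable_mult_indicator\<close>)
    then show "code f = code g"
      by (intro ext) (simp add: code_def)
  qed
qed

sublocale K: L2_model \<nu> "L2_space \<nu> code" code
  by (rule L2_model_L2_space) (rule code_eq_iff)

sublocale ell2: L2_model "count_space V" "ell2 V" "extend_zero V"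
  by (rule L2_model_ell2)

lemma extend_zero_id: "f \<in> carrier (ell2 V) \<Longrightarrow> extend_zero V f = f"
  by (auto simp: carrier_ell2 extend_zero_def)

lemma shift_map_add: "shift_map V E lam (\<lambda>v. f v + g v) = (\<lambda>v. shift_map V E lam f v + shift_map V E lam g v)"
  by (auto simp: shift_map_def distrib_left)

lemma shift_map_smult: "shift_map V E lam (\<lambda>v. c * f v) = (\<lambda>v. c * shift_map V E lam f v)"
  by (auto simp: shift_map_def)

lemma linear_weighted_shift: "linear_operator (ell2 V) (weighted_shift V E lam)"
proof -
  have ops: "f \<oplus>\<^bsub>ell2 V\<^esub> g = (\<lambda>v. f v + g v)" "c \<odot>\<^bsub>ell2 V\<^esub> f = (\<lambda>v. c * f v)"
    "\<zero>\<^bsub>ell2 V\<^esub> = (\<lambda>v. 0)" for f g c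
    by (simp_all add: ell2_def)
  have zero: "shift_map V E lam (\<lambda>v. 0) = (\<lambda>v. 0)"
    by (auto simp: shift_map_def)
  show ?thesis
    unfolding linear_operator_def
    using ell2.M.zero_closed ell2.M.a_closed ell2.smult_mem
    by (auto simp: weighted_shift_def single_valued_def ops zero shift_map_add shift_map_smult)
qed

text \<open>\<open>\<ell>\<^sup>2(V)\<close> is embedded as the functions that do not depend on the second variable.\<close>

definition lift :: "('v \<Rightarrow> complex) \<Rightarrow> 'v \<times> real \<Rightarrow> complex" where
  "lift f x = f (fst x)"

lemma measurable_lift [measurable]: "lift f \<in> borel_measurable base"
  unfolding lift_def[abs_def] by (rule measurable_vertex) simp

lemma nn_integral_lift:
  "(\<integral>\<^sup>+x. ennreal ((cmod (lift f x))\<^sup>2) \<partial>\<nu>) = (\<integral>\<^sup>+v. ennreal ((cmod (f v))\<^sup>2) \<partial>count_space V)"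
proof -
  have "(\<integral>\<^sup>+s. c \<partial>\<kappa> v) = c" if "v \<in> V" for v and c :: ennreal
    using prob_space.emeasure_space_1[OF prob[OF that]] by simp
  moreover have "(\<lambda>x. ennreal ((cmod (lift f x))\<^sup>2)) \<in> borel_measurable base"
    by measurable
  ultimately show ?thesis
    by (simp add: nn_integral_\<nu>) (auto intro!: nn_integral_cong simp: lift_def)
qed

lemma L2_lift_iff: "lift f \<in> L2 \<nu> \<longleftrightarrow> f \<in> L2 (count_space V)"
  by (simp add: L2_iff nn_integral_lift borel_measurable_\<nu>)

lemma lift_mem: "f \<in> carrier (ell2 V) \<Longrightarrow> lift f \<in> L2 \<nu>"
  by (simp add: L2_lift_iff carrier_ell2)

lemma isometric_lift: "isometric_embedding (ell2 V) (L2_space \<nu> code) (\<lambda>f. code (lift f))"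
proof -
  let ?J = "\<lambda>f. code (lift f)"
  have mem: "?J f \<in> carrier (L2_space \<nu> code)" if "f \<in> carrier (ell2 V)" for f
    using that by (intro K.name_mem lift_mem)
  have add: "?J (f \<oplus>\<^bsub>ell2 V\<^esub> g) = ?J f \<oplus>\<^bsub>L2_space \<nu> code\<^esub> ?J g"
    if "f \<in> carrier (ell2 V)" "g \<in> carrier (ell2 V)" for f g
    using that by (simp add: K.add_eq lift_mem) (simp add: ell2_def lift_def[abs_def])
  have smult: "?J (c \<odot>\<^bsub>ell2 V\<^esub> f) = c \<odot>\<^bsub>L2_space \<nu> code\<^esub> ?J f"
    if "f \<in> carrier (ell2 V)" for f c
    using that by (simp add: K.smult_eq lift_mem) (simp add: ell2_def lift_def[abs_def])
  have norm: "hnorm (L2_space \<nu> code) (?J f) = hnorm (ell2 V) f" if f: "f \<in> carrier (ell2 V)" for f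
  proof -
    have "ennreal ((hnorm (L2_space \<nu> code) (?J f))\<^sup>2) = ennreal ((hnorm (ell2 V) f)\<^sup>2)"
      using K.ennreal_hnorm_sq[OF lift_mem[OF f]] ell2.ennreal_hnorm_sq[of f] f
      by (simp add: nn_integral_lift extend_zero_id carrier_ell2[of f])
    then show ?thesis
      using K.hnorm_nonneg[OF mem[OF f]] ell2.hnorm_nonneg[OF f]
      by (subst (asm) ennreal_inj) (auto simp: power2_eq_iff_nonneg)
  qed
  have "ip (L2_space \<nu> code) (?J f) (?J g) = ip (ell2 V) f g"
    if "f \<in> carrier (ell2 V)" "g \<in> carrier (ell2 V)" for f g
    by (rule ell2.norm_preserving_imp_ip_preserving[OF K.complex_inner_product_space_axioms mem add smult norm that])
  then show ?thesis
    using mem add smult by (auto simp: isometric_embedding_def)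
qed

text \<open>The shift factors through multiplication by the square root of the second variable. The
  only points at which this could fail have \<open>s = 0\<close>, and they are negligible wherever the shift
  is not zero.\<close>

lemma push_sqrt_lift:
  "AE x in \<nu>. push (\<lambda>x. complex_of_real (sqrt (snd x)) * lift f x) x = lift (shift_map V E lam f) x"
proof -
  have [measurable]: "(\<lambda>x. complex_of_real (sqrt (snd x)) * lift f x) \<in> borel_measurable base"
    by measurable
  have "(AE x in \<nu>. push (\<lambda>x. complex_of_real (sqrt (snd x)) * lift f x) x = lift (shift_map V E lam f) x)
    \<longleftrightarrow> (\<forall>v\<in>V. AE s in \<kappa> v. push (\<lambda>x. complex_of_real (sqrt (snd x)) * lift f x) (v, s)
          = lift (shift_map V E lam f) (v, s))"
    by (rule AE_\<nu>) measurable
  also have "\<dots>"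
  proof
    fix v assume v: "v \<in> V"
    have "AE s in \<kappa> v. v \<in> nonroots V E \<longrightarrow> lam v \<noteq> 0 \<longrightarrow> s \<noteq> 0"
      using AE_positive[of v] by (cases "v \<in> nonroots V E \<and> lam v \<noteq> 0") auto
    then show "AE s in \<kappa> v. push (\<lambda>x. complex_of_real (sqrt (snd x)) * lift f x) (v, s)
          = lift (shift_map V E lam f) (v, s)"
      using nonneg_\<kappa>[OF v]
      by eventually_elim (auto simp: push_def lift_def shift_map_def)
  qed
  finally show ?thesis .
qed

theorem weighted_shift_subnormal:
  assumes basis: "\<And>v. v \<in> V \<Longrightarrow> basis_vec v \<in> Domain (weighted_shift V E lam)"
  shows "subnormal (ell2 V) (weighted_shift V E lam)"
proof -
  let ?K = "L2_space \<nu> code" and ?S = "weighted_shift V E lam"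
  let ?M = "K.mult_operator (\<lambda>x. sqrt (snd x))"
  have push_L2: "push f \<in> L2 \<nu>" if "f \<in> L2 \<nu>" for f
    using that measurable_push[of f] by (auto simp: L2_iff nn_integral_push borel_measurable_\<nu>)
  have push_diff: "push (\<lambda>x. f x - g x) = (\<lambda>x. push f x - push g x)" for f g
    by (auto simp: push_def fun_eq_iff field_simps)
  \<comment> \<open>Almost everywhere equality is preserved because \<open>push\<close> is linear and isometric.\<close>
  have push_cong: "code (push f) = code (push g)" if "f \<in> L2 \<nu>" "g \<in> L2 \<nu>" "code f = code g" for f g
  proof -
    have [measurable]: "f \<in> borel_measurable base" "g \<in> borel_measurable base"
      using that by (simp_all add: L2_\<nu>D)
    have "AE x in \<nu>. f x = g x"
      using that code_eq_iff by blast
    then have "(\<integral>\<^sup>+x. ennreal ((cmod (f x - g x))\<^sup>2) \<partial>\<nu>) = (\<integral>\<^sup>+x. 0 \<partial>\<nu>)"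
      by (intro nn_integral_cong_AE) auto
    then have "(\<integral>\<^sup>+x. ennreal ((cmod (push f x - push g x))\<^sup>2) \<partial>\<nu>) = 0"
      using nn_integral_push[of "\<lambda>x. f x - g x"] by (simp add: push_diff)
    then have "AE x in \<nu>. push f x = push g x"
      by (subst (asm) nn_integral_0_iff_AE) (auto simp: borel_measurable_\<nu>)
    then show ?thesis
      using that code_eq_iff push_L2 by blast
  qed
  define U where "U x = code (push (inv_into (L2 \<nu>) code x))" for x
  have U: "U (code f) = code (push f)" if "f \<in> L2 \<nu>" for f
  proof -
    have "code f \<in> code ` L2 \<nu>" using that by blast
    from push_cong[OF inv_into_into[OF this] that f_inv_into_f[OF this]]
    show ?thesis by (simp only: U_def)
  qed
  have "\<exists>N. normal_operator (double ?K) N \<and>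
    (\<forall>(x, y) \<in> ?M. (interleave x \<zero>\<^bsub>?K\<^esub>, interleave (U y) \<zero>\<^bsub>?K\<^esub>) \<in> N)"
  proof (rule isometry_selfadjoint_normal_extension)
    show "complex_hilbert_space ?K" ..
    show "linear_operator ?K ?M" by (rule K.linear_mult_operator)
    show "adjoint_operator ?K ?M = ?M"
      by (rule K.adjoint_mult_operator) (auto simp: borel_measurable_\<nu>)
  next
    fix x assume "x \<in> carrier ?K"
    then obtain f where f: "f \<in> L2 \<nu>" "x = code f" by (auto simp: K.carrier_eq)
    then have fb: "f \<in> borel_measurable base"
      by (simp add: L2_\<nu>D)
    show "U x \<in> carrier ?K"
      using f by (simp add: U push_L2 K.name_mem)
    show "hnorm ?K (U x) = hnorm ?K x"
    proof -
      have "ennreal ((hnorm ?K (U x))\<^sup>2) = ennreal ((hnorm ?K x)\<^sup>2)"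
        using f fb by (simp add: U push_L2 K.ennreal_hnorm_sq nn_integral_push)
      then show ?thesis
        using f by (subst (asm) ennreal_inj)
          (auto simp: U push_L2 K.name_mem K.hnorm_nonneg power2_eq_iff_nonneg)
    qed
    show "U (c \<odot>\<^bsub>?K\<^esub> x) = c \<odot>\<^bsub>?K\<^esub> U x" for c
    proof -
      have "push (\<lambda>x. c * f x) = (\<lambda>x. c * push f x)"
        by (auto simp: push_def fun_eq_iff)
      then show ?thesis
        using f by (simp add: K.smult_eq U L2_smult push_L2)
    qed
    fix y assume "y \<in> carrier ?K"
    then obtain g where g: "g \<in> L2 \<nu>" "y = code g" by (auto simp: K.carrier_eq)
    have "push (\<lambda>x. f x + g x) = (\<lambda>x. push f x + push g x)"
      by (auto simp: push_def fun_eq_iff field_simps)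
    then show "U (x \<oplus>\<^bsub>?K\<^esub> y) = U x \<oplus>\<^bsub>?K\<^esub> U y"
      using f g by (simp add: K.add_eq U L2_add push_L2)
  next
    fix x y assume "(x, y) \<in> ?M"
    then obtain f g where f: "f \<in> L2 \<nu>" "g \<in> L2 \<nu>" "x = code f" "y = code g"
      "AE x in \<nu>. g x = complex_of_real (sqrt (snd x)) * f x"
      by (auto simp: K.mult_operator_def)
    have fb [measurable]: "f \<in> borel_measurable base" "g \<in> borel_measurable base"
      using f by (simp_all add: L2_\<nu>D)
    let ?sf = "\<lambda>x. complex_of_real (sqrt (snd x)) * f x"
    have sf: "?sf \<in> L2 \<nu>"
    proof (rule L2_bound[OF f(2)])
      show "AE x in \<nu>. cmod (?sf x) \<le> cmod (g x)"
        using f(5) by eventually_elim simp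
    qed (auto simp: borel_measurable_\<nu>)
    have "code g = code ?sf"
      using f(5) f(2) sf code_eq_iff by blast
    then have "U y = code (push ?sf)"
      using U[OF sf] f(4) by simp
    also have "push ?sf = (\<lambda>x. complex_of_real (sqrt (snd x)) * push f x)"
      by (auto simp: push_def fun_eq_iff)
    finally show "(U x, U y) \<in> ?M"
      using f(1,3) push_L2[OF f(1)] push_L2[OF sf] U[OF f(1)]
      by (auto simp: \<open>push ?sf = _\<close> intro: K.mult_operatorI)
  qed
  then obtain N where N: "normal_operator (double ?K) N"
    "\<And>x y. (x, y) \<in> ?M \<Longrightarrow> (interleave x \<zero>\<^bsub>?K\<^esub>, interleave (U y) \<zero>\<^bsub>?K\<^esub>) \<in> N"
    by blast
  define J where "J f = interleave (code (lift f)) \<zero>\<^bsub>?K\<^esub>" for f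
  have J: "isometric_embedding (ell2 V) (double ?K) J"
    using isometric_lift unfolding isometric_embedding_def
    by (auto simp: J_def K.ip_zero)
  have ext: "(J f, J f') \<in> N" if "(f, f') \<in> ?S" for f f'
  proof -
    have f: "f \<in> carrier (ell2 V)" "f' \<in> carrier (ell2 V)" "f' = shift_map V E lam f"
      using that by (auto simp: weighted_shift_def)
    let ?sf = "\<lambda>x. complex_of_real (sqrt (snd x)) * lift f x"
    have [measurable]: "?sf \<in> borel_measurable base" by measurable
    have push: "AE x in \<nu>. push ?sf x = lift f' x"
      unfolding f(3) by (rule push_sqrt_lift)
    have "(\<integral>\<^sup>+x. ennreal ((cmod (?sf x))\<^sup>2) \<partial>\<nu>) = (\<integral>\<^sup>+x. ennreal ((cmod (push ?sf x))\<^sup>2) \<partial>\<nu>)"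
      by (rule nn_integral_push[symmetric]) measurable
    also have "\<dots> = (\<integral>\<^sup>+x. ennreal ((cmod (lift f' x))\<^sup>2) \<partial>\<nu>)"
      by (rule nn_integral_cong_AE) (use push in \<open>auto\<close>)
    finally have sf: "?sf \<in> L2 \<nu>"
      using lift_mem[OF f(2)] by (simp add: L2_iff borel_measurable_\<nu>)
    have "(code (lift f), code ?sf) \<in> ?M"
      by (rule K.mult_operatorI[OF lift_mem[OF f(1)] sf]) simp
    moreover have "U (code ?sf) = code (lift f')"
      unfolding U[OF sf] code_eq_iff[OF push_L2[OF sf] lift_mem[OF f(2)]] by (rule push)
    ultimately show ?thesis
      using N(2)[of "code (lift f)" "code ?sf"] by (simp add: J_def)
  qed
  have dense: "densely_defined (ell2 V) ?S"
  proof (rule ell2.densely_definedI[OF linear_weighted_shift])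
    fix f assume f: "f \<in> carrier (ell2 V)"
      and orth: "\<And>g. g \<in> Domain ?S \<Longrightarrow> ip (ell2 V) f g = 0"
    have "f v = 0" if v: "v \<in> V" for v
    proof -
      have "ip (ell2 V) f (basis_vec v) = (\<Sum>\<^sub>\<infinity>w\<in>V. f w * cnj (basis_vec v w))"
        by (simp add: ell2_def)
      also have "\<dots> = (\<Sum>\<^sub>\<infinity>w\<in>{v}. f w)"
        by (rule infsum_cong_neutral) (use v in \<open>auto simp: basis_vec_def indicator_def\<close>)
      finally have "ip (ell2 V) f (basis_vec v) = f v" by simp
      then show ?thesis using orth[OF basis[OF v]] by simp
    qed
    then show "f = \<zero>\<^bsub>ell2 V\<^esub>"
      using f by (auto simp: carrier_ell2 ell2_def)
  qed
  show ?thesis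
    unfolding subnormal_def
    using linear_weighted_shift dense J N(1) ext complex_hilbert_space_double[OF K.complex_hilbert_space_axioms]
      ell2.complex_hilbert_space_axioms
    by (intro conjI exI[of _ "double ?K"] exI[of _ J] exI[of _ N]) auto
qed

end

text \<open>Passes from the consistency of the measures of sets, with \<open>w s = 1 / s\<close>, to that of integrals
  of nonnegative functions, by the usual induction.\<close>

lemma nn_integral_weighted_sum_of_measures:
  fixes N :: "real measure" and \<kappa> :: "'v \<Rightarrow> real measure" and w g :: "real \<Rightarrow> ennreal"
  assumes N: "sets N = sets borel" and \<kappa>: "\<And>v. v \<in> C \<Longrightarrow> sets (\<kappa> v) = sets borel"
    and w [measurable]: "w \<in> borel_measurable borel"
    and eq: "\<And>A. A \<in> sets borel \<Longrightarrow> emeasure N A =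
      (\<integral>\<^sup>+v. a v * (\<integral>\<^sup>+s. indicator A s * w s \<partial>\<kappa> v) \<partial>count_space C) + e * indicator A 0"
    and g: "g \<in> borel_measurable borel"
  shows "(\<integral>\<^sup>+s. g s \<partial>N) = (\<integral>\<^sup>+v. a v * (\<integral>\<^sup>+s. g s * w s \<partial>\<kappa> v) \<partial>count_space C) + e * g 0"
proof -
  note N[measurable_cong]
  have m: "f \<in> borel_measurable (\<kappa> v)" if "v \<in> C" "f \<in> borel_measurable borel"
    for v and f :: "real \<Rightarrow> ennreal"
    using that \<kappa>[OF that(1)] by (simp cong: measurable_cong_sets)
  show ?thesis
    using g
  proof (induction rule: borel_measurable_induct)
    case (cong f g)
    then have "f = g" by auto
    then show ?case using cong by simp
  next
    case (set A)
    then show ?case using eq[of A] N by (simp add: nn_integral_indicator)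
  next
    case (mult u c)
    note [measurable] = mult.hyps(2)
    have "(\<integral>\<^sup>+v. a v * (\<integral>\<^sup>+s. c * u s * w s \<partial>\<kappa> v) \<partial>count_space C)
        = (\<integral>\<^sup>+v. c * (a v * (\<integral>\<^sup>+s. u s * w s \<partial>\<kappa> v)) \<partial>count_space C)"
      by (intro nn_integral_cong) (simp add: nn_integral_cmult m mult.assoc mult.left_commute)
    then show ?case
      using mult.IH by (simp add: nn_integral_cmult distrib_left mult.assoc mult.left_commute)
  next
    case (add u v)
    note [measurable] = add.hyps(1,3)
    have "(\<integral>\<^sup>+x. a x * (\<integral>\<^sup>+s. (v s + u s) * w s \<partial>\<kappa> x) \<partial>count_space C)
        = (\<integral>\<^sup>+x. a x * (\<integral>\<^sup>+s. v s * w s \<partial>\<kappa> x) + a x * (\<integral>\<^sup>+s. u s * w s \<partial>\<kappa> x) \<partial>count_space C)"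
    proof (rule nn_integral_cong)
      fix x assume "x \<in> space (count_space C)"
      then have x: "x \<in> C" by simp
      have "(\<integral>\<^sup>+s. v s * w s + u s * w s \<partial>\<kappa> x) = (\<integral>\<^sup>+s. v s * w s \<partial>\<kappa> x) + (\<integral>\<^sup>+s. u s * w s \<partial>\<kappa> x)"
        by (intro nn_integral_add m[OF x]; measurable)
      then show "a x * (\<integral>\<^sup>+s. (v s + u s) * w s \<partial>\<kappa> x)
          = a x * (\<integral>\<^sup>+s. v s * w s \<partial>\<kappa> x) + a x * (\<integral>\<^sup>+s. u s * w s \<partial>\<kappa> x)"
        by (simp add: distrib_right distrib_left)
    qed
    then show ?case
      using add.IH by (simp add: nn_integral_add distrib_left add_ac)
  next
    case (seq U)
    note [measurable] = seq.hyps(1)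
    have incU: "incseq (\<lambda>i. U i s)" for s
      using seq.hyps(3) by (auto simp: incseq_def le_fun_def)
    have incw: "incseq (\<lambda>i s. U i s * w s)"
      using seq.hyps(3) by (auto simp: incseq_def le_fun_def intro!: mult_right_mono)
    have inca: "incseq (\<lambda>i v. a v * (\<integral>\<^sup>+s. U i s * w s \<partial>\<kappa> v))"
      using incw by (auto simp: incseq_def le_fun_def intro!: mult_left_mono nn_integral_mono)
    have "(\<integral>\<^sup>+s. (SUP i. U i) s \<partial>N) = (SUP i. \<integral>\<^sup>+s. U i s \<partial>N)"
      unfolding SUP_apply using seq.hyps(3) by (intro nn_integral_monotone_convergence_SUP) auto
    also have "\<dots> = (SUP i. (\<integral>\<^sup>+v. a v * (\<integral>\<^sup>+s. U i s * w s \<partial>\<kappa> v) \<partial>count_space C) + e * U i 0)"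
      by (simp add: seq.IH)
    also have "\<dots> = (SUP i. \<integral>\<^sup>+v. a v * (\<integral>\<^sup>+s. U i s * w s \<partial>\<kappa> v) \<partial>count_space C) + (SUP i. e * U i 0)"
    proof (rule ennreal_SUP_add)
      show "incseq (\<lambda>i. \<integral>\<^sup>+v. a v * (\<integral>\<^sup>+s. U i s * w s \<partial>\<kappa> v) \<partial>count_space C)"
        using inca by (auto simp: incseq_def le_fun_def intro!: nn_integral_mono)
      show "incseq (\<lambda>i. e * U i 0)"
        using incU by (auto simp: incseq_def intro!: mult_left_mono)
    qed
    also have "(SUP i. \<integral>\<^sup>+v. a v * (\<integral>\<^sup>+s. U i s * w s \<partial>\<kappa> v) \<partial>count_space C)
        = (\<integral>\<^sup>+v. (SUP i. a v * (\<integral>\<^sup>+s. U i s * w s \<partial>\<kappa> v)) \<partial>count_space C)"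
      using inca by (intro nn_integral_monotone_convergence_SUP[symmetric]) auto
    also have "\<dots> = (\<integral>\<^sup>+v. a v * (\<integral>\<^sup>+s. (SUP i. U i) s * w s \<partial>\<kappa> v) \<partial>count_space C)"
    proof (rule nn_integral_cong)
      fix v assume "v \<in> space (count_space C)"
      then have v: "v \<in> C" by simp
      have "(\<integral>\<^sup>+s. (SUP i. U i) s * w s \<partial>\<kappa> v) = (\<integral>\<^sup>+s. (SUP i. U i s * w s) \<partial>\<kappa> v)"
        by (simp add: SUP_mult_right_ennreal image_comp)
      also have "\<dots> = (SUP i. \<integral>\<^sup>+s. U i s * w s \<partial>\<kappa> v)"
        using incw by (intro nn_integral_monotone_convergence_SUP m[OF v]) auto
      finally show "(SUP i. a v * (\<integral>\<^sup>+s. U i s * w s \<partial>\<kappa> v)) = a v * (\<integral>\<^sup>+s. (SUP i. U i) s * w s \<partial>\<kappa> v)"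
        by (simp add: SUP_mult_left_ennreal)
    qed
    also have "(SUP i. e * U i 0) = e * (SUP i. U i) 0"
      by (simp add: SUP_mult_left_ennreal image_comp)
    finally show ?case .
  qed
qed

theorem theorem5p2p1:
  fixes V :: "'v set" and E :: "'v rel" and lam :: "'v \<Rightarrow> complex"
    and \<mu> :: "'v \<Rightarrow> real measure" and \<epsilon> :: "'v \<Rightarrow> real"
  assumes "directed_tree V E"
    and "E_span V \<subseteq> D_infinity (ell2 V) (weighted_shift V E lam)"
    and "\<And>v. v \<in> V \<Longrightarrow> prob_space (\<mu> v)"
    and "\<And>v. v \<in> V \<Longrightarrow> sets (\<mu> v) = sets borel_Rplus"
    and "\<And>v. v \<in> V \<Longrightarrow> \<epsilon> v \<ge> 0"
    and "\<And>u \<sigma>. \<lbrakk>u \<in> V; \<sigma> \<in> sets borel_Rplus\<rbrakk> \<Longrightarrow>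
      emeasure (\<mu> u) \<sigma> =
        (\<Sum>\<^sub>\<infinity>v\<in>Chi E u. ennreal ((cmod (lam v))\<^sup>2) * (\<integral>\<^sup>+s\<in>\<sigma>. 1 / ennreal s \<partial>\<mu> v))
        + ennreal (\<epsilon> u) * emeasure (return borel_Rplus 0) \<sigma>"
  shows "subnormal (ell2 V) (weighted_shift V E lam)"
proof -
  interpret directed_tree V E by fact
  \<comment> \<open>the same measures on the whole line\<close>
  define \<kappa> where "\<kappa> v = distr (\<mu> v) borel (\<lambda>s. s)" for v
  have meas [measurable]: "(\<lambda>s. s) \<in> borel_measurable (\<mu> v)" if "v \<in> V" for v
    by (subst measurable_cong_sets[OF assms(4)[OF that] refl]) (simp add: measurable_restrict_space1)
  have space: "space (\<mu> v) = {0..}" if "v \<in> V" for v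
    using sets_eq_imp_space_eq[OF assms(4)[OF that]] by (simp add: space_restrict_space)
  have child: "v \<in> V" if "v \<in> Chi E u" for u v
    using that edges by (auto simp: Chi_def)
  have nn_\<kappa>: "(\<integral>\<^sup>+s. g s \<partial>\<kappa> v) = (\<integral>\<^sup>+s. g s \<partial>\<mu> v)"
    if "v \<in> V" "g \<in> borel_measurable borel" for v and g :: "real \<Rightarrow> ennreal"
    unfolding \<kappa>_def using meas that by (subst nn_integral_distr) auto
  interpret consistent_measures V E lam \<kappa> \<epsilon>
  proof (intro consistent_measures.intro consistent_measures_axioms.intro assms(1))
    fix v assume v: "v \<in> V"
    show "prob_space (\<kappa> v)"
      unfolding \<kappa>_def by (rule prob_space.prob_space_distr[OF assms(3)[OF v] meas[OF v]])
    show "sets (\<kappa> v) = sets borel" by (simp add: \<kappa>_def)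
    show "AE s in \<kappa> v. 0 \<le> s"
      unfolding \<kappa>_def using space[OF v] by (subst AE_distr_iff[OF meas[OF v]]) auto
    fix g :: "real \<Rightarrow> ennreal" assume g: "g \<in> borel_measurable borel"
    show "(\<integral>\<^sup>+s. g s \<partial>\<kappa> v) =
        (\<integral>\<^sup>+w. ennreal ((cmod (lam w))\<^sup>2) * (\<integral>\<^sup>+s. g s * (1 / ennreal s) \<partial>\<kappa> w) \<partial>count_space (Chi E v))
        + ennreal (\<epsilon> v) * g 0"
    proof (rule nn_integral_weighted_sum_of_measures[OF _ _ _ _ g])
      fix A :: "real set" assume A [measurable]: "A \<in> sets borel"
      then have \<sigma>: "A \<inter> {0..} \<in> sets borel_Rplus"
        by (auto simp: sets_restrict_space)
      have "emeasure (\<kappa> v) A = emeasure (\<mu> v) (A \<inter> {0..})"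
        unfolding \<kappa>_def using A space[OF v] by (simp add: emeasure_distr meas[OF v])
      also have "\<dots> = (\<integral>\<^sup>+w. ennreal ((cmod (lam w))\<^sup>2) * (\<integral>\<^sup>+s\<in>A \<inter> {0..}. 1 / ennreal s \<partial>\<mu> w) \<partial>count_space (Chi E v))
          + ennreal (\<epsilon> v) * emeasure (return borel_Rplus 0) (A \<inter> {0..})"
        unfolding infsum_eq_nn_integral_count_space[symmetric] by (rule assms(6)[OF v \<sigma>])
      also have "emeasure (return borel_Rplus 0) (A \<inter> {0..}) = indicator A 0"
        using \<sigma> by (simp add: indicator_def)
      also have "(\<integral>\<^sup>+w. ennreal ((cmod (lam w))\<^sup>2) * (\<integral>\<^sup>+s\<in>A \<inter> {0..}. 1 / ennreal s \<partial>\<mu> w) \<partial>count_space (Chi E v))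
          = (\<integral>\<^sup>+w. ennreal ((cmod (lam w))\<^sup>2) * (\<integral>\<^sup>+s. indicator A s * (1 / ennreal s) \<partial>\<kappa> w) \<partial>count_space (Chi E v))"
      proof (rule nn_integral_cong)
        fix w assume "w \<in> space (count_space (Chi E v))"
        then have w: "w \<in> V" using child by simp
        have "(\<integral>\<^sup>+s. indicator A s * (1 / ennreal s) \<partial>\<kappa> w) = (\<integral>\<^sup>+s. indicator A s * (1 / ennreal s) \<partial>\<mu> w)"
          by (rule nn_\<kappa>[OF w]) measurable
        also have "\<dots> = (\<integral>\<^sup>+s\<in>A \<inter> {0..}. 1 / ennreal s \<partial>\<mu> w)"
          using space[OF w] by (intro nn_integral_cong) (auto simp: indicator_def)
        finally show "ennreal ((cmod (lam w))\<^sup>2) * (\<integral>\<^sup>+s\<in>A \<inter> {0..}. 1 / ennreal s \<partial>\<mu> w)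
            = ennreal ((cmod (lam w))\<^sup>2) * (\<integral>\<^sup>+s. indicator A s * (1 / ennreal s) \<partial>\<kappa> w)" by simp
      qed
      finally show "emeasure (\<kappa> v) A =
          (\<integral>\<^sup>+w. ennreal ((cmod (lam w))\<^sup>2) * (\<integral>\<^sup>+s. indicator A s * (1 / ennreal s) \<partial>\<kappa> w) \<partial>count_space (Chi E v))
          + ennreal (\<epsilon> v) * indicator A 0" .
    qed (auto simp: \<kappa>_def)
  qed
  show ?thesis
  proof (rule weighted_shift_subnormal)
    fix v assume v: "v \<in> V"
    have "basis_vec v \<in> E_span V"
      unfolding E_span_def mem_Collect_eq
      by (intro exI[of _ "{v}"] exI[of _ "\<lambda>_. 1"]) (use v in simp)
    then have "basis_vec v \<in> Domain (weighted_shift V E lam ^^ 1)"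
      using assms(2) unfolding D_infinity_def by blast
    then show "basis_vec v \<in> Domain (weighted_shift V E lam)" by simp
  qed
qed

end
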